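(* Let $W$ be a countable set and let $\Upsilon$ be a closed subgroup of $\mathrm{Sym}(W)$ (topology of pointwise convergence) acting transitively on $W$. Let $G$ be a simple non-abelian finite group acting regularly on a finite set $\Delta$, and let $\pi:\Delta\times W\to W$, $\pi(\delta,w)=w$. Let $\mathcal{F}$ be the set of closed subgroups $F$ of $\mathrm{Sym}(\Delta\times W)$ which preserve the partition $\{\pi^{-1}(w): w\in W\}$ and satisfy: the induced homomorphism $\mu_F:F\to\mathrm{Sym}(W)$, $\mu_F(g)(w)=\pi(g\pi^{-1}(w))$, has image $\mu_F(F)=\Upsilon$, and for every $w\in W$ the permutation groups induced on $\pi^{-1}(w)\cong\Delta$ by $F$ and by $\operatorname{Ker}\mu_F$ are both equal to $G$. Let $\mathcal{K}=\{\operatorname{Ker}\mu_F : F\in\mathcal{F}\}$; each element of $\mathcal{K}$ is a subgroup of $G^W$ (functions $f:W\to G$, acting by $f(\delta,w)=(f(w)\delta,w)$). Call $F_1,F_2\in\mathcal{F}$ isomorphic if there is a bijection $\phi$ of $\Delta\times W$ with $\phi(\pi^{-1}(w))=\pi^{-1}(w)$ for all $w$ and $\phi F_1\phi^{-1}=F_2$; define the equivalence relation $R$ on $\mathcal{K}$ by $\operatorname{Ker}\mu_{F_1}\,R\,\operatorname{Ker}\mu_{F_2}$ iff $F_1$ and $F_2$ are isomorphic, and write $[K]$ for the $R$-class of $K$. Let $\mathcal{C}$ be the set of all $\Upsilon$-congruences ($\Upsilon$-invariant equivalence relations) on $W$. For $\rho\in\mathcal{C}$ let $K_\rho=\{f\in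 G^W : f \text{ is constant on every } \rho\text{-class}\}$. For $K\in\mathcal{K}$ and $w_1,\dots,w_k\in W$ let $K(w_1,\dots,w_k)=\{f|_{\{w_1,\dots,w_k\}} : f\in K\}$, and define the relation $\rho_K$ on $W$ by $w_i\,\rho_K\,w_j$ iff $K(w_i,w_j)\cong G$. Then $\Psi(\rho)=[K_\rho]$ is a well-defined bijection $\Psi:\mathcal{C}\to\mathcal{K}/R$, and its inverse is $\Phi([K])=\rho_K$ (in particular $\rho_K$ depends only on $[K]$ and lies in $\mathcal{C}$).
   Context: $G^W$ carries the product topology ($G$ discrete). $\mathrm{Sym}(\Delta\times W)$ carries the topology of pointwise convergence. *)

theory Defs
  imports
    "HOL-Analysis.Abstract_Topology_2"
    "HOL-Analysis.Function_Topology"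
    "HOL-Algebra.Group_Action"
    "HOL-Algebra.SimpleGroups"
    "HOL-Algebra.Product_Groups"
begin

text \<open>Permutations of \<open>S\<close> are the elements of \<^term>\<open>Bij S\<close>, i.e. bijections of \<open>S\<close> that are
  extensional outside \<open>S\<close>.  Hence \<^term>\<open>Bij S\<close> is a subset of the product space below, and the
  topology of pointwise convergence is the subspace topology.\<close>

definition Sym_topology :: "'a set \<Rightarrow> ('a \<Rightarrow> 'a) topology" where
  "Sym_topology S = subtopology (product_topology (\<lambda>_. discrete_topology S) S) (Bij S)"

definition closed_subgroup_Sym :: "('a \<Rightarrow> 'a) set \<Rightarrow> 'a set \<Rightarrow> bool" where
  "closed_subgroup_Sym H S \<longleftrightarrow> subgroup H (BijGroup S) \<and> closedin (Sym_topology S) H"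

text \<open>Non-emptiness of \<open>E\<close> has to be required, since every action on the empty set satisfies the
  other conditions vacuously.\<close>

locale regular_action = transitive_action +
  assumes nonempty: "E \<noteq> {}"
    and trivial_stabilizer: "x \<in> E \<Longrightarrow> stabilizer G \<phi> x = {\<one>}"

definition fibre :: "'d set \<Rightarrow> 'w set \<Rightarrow> 'w \<Rightarrow> ('d \<times> 'w) set" where
  "fibre \<Delta> W w = {x \<in> \<Delta> \<times> W. snd x = w}"

definition preserves_fibres :: "'d set \<Rightarrow> 'w set \<Rightarrow> ('d \<times> 'w \<Rightarrow> 'd \<times> 'w) set \<Rightarrow> bool" where
  "preserves_fibres \<Delta> W F \<longleftrightarrow> (\<forall>g\<in>F. \<forall>w\<in>W. g ` fibre \<Delta> W w \<in> fibre \<Delta> W ` W)"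

definition mu :: "'d set \<Rightarrow> 'w set \<Rightarrow> ('d \<times> 'w \<Rightarrow> 'd \<times> 'w) \<Rightarrow> 'w \<Rightarrow> 'w" where
  "mu \<Delta> W g = (\<lambda>w\<in>W. the_elem (snd ` g ` fibre \<Delta> W w))"

definition Ker_mu ::
    "'d set \<Rightarrow> 'w set \<Rightarrow> ('d \<times> 'w \<Rightarrow> 'd \<times> 'w) set \<Rightarrow> ('d \<times> 'w \<Rightarrow> 'd \<times> 'w) set" where
  "Ker_mu \<Delta> W F = kernel (BijGroup (\<Delta> \<times> W)\<lparr>carrier := F\<rparr>) (BijGroup W) (mu \<Delta> W)"

text \<open>The permutation group induced on the fibre over \<open>w\<close> by its setwise stabilizer in \<open>H\<close>,
  carried over to \<open>\<Delta>\<close> by the identification of \<open>(\<delta>, w)\<close> with \<open>\<delta>\<close>.\<close>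

definition induced_on_fibre ::
    "'d set \<Rightarrow> 'w set \<Rightarrow> ('d \<times> 'w \<Rightarrow> 'd \<times> 'w) set \<Rightarrow> 'w \<Rightarrow> ('d \<Rightarrow> 'd) set" where
  "induced_on_fibre \<Delta> W H w =
    (\<lambda>g. \<lambda>\<delta>\<in>\<Delta>. fst (g (\<delta>, w))) ` {g \<in> H. g ` fibre \<Delta> W w = fibre \<Delta> W w}"

text \<open>In the following, the permutation group \<open>G\<close> on \<open>\<Delta>\<close> is the image of \<open>G\<close> under its action
  \<open>act\<close>.\<close>

definition cover_groups ::
    "('g, 'b) monoid_scheme \<Rightarrow> ('g \<Rightarrow> 'd \<Rightarrow> 'd) \<Rightarrow> 'd set \<Rightarrow> 'w set \<Rightarrow> ('w \<Rightarrow> 'w) set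
      \<Rightarrow> ('d \<times> 'w \<Rightarrow> 'd \<times> 'w) set set" where
  "cover_groups G act \<Delta> W \<Upsilon> =
    {F. closed_subgroup_Sym F (\<Delta> \<times> W) \<and> preserves_fibres \<Delta> W F \<and> mu \<Delta> W ` F = \<Upsilon> \<and>
        (\<forall>w\<in>W. induced_on_fibre \<Delta> W F w = act ` carrier G \<and>
               induced_on_fibre \<Delta> W (Ker_mu \<Delta> W F) w = act ` carrier G)}"

abbreviation power_group :: "('g, 'b) monoid_scheme \<Rightarrow> 'w set \<Rightarrow> ('w \<Rightarrow> 'g) monoid" where
  "power_group G W \<equiv> product_group W (\<lambda>_. G)"

definition fibrewise_act ::
    "('g \<Rightarrow> 'd \<Rightarrow> 'd) \<Rightarrow> 'd set \<Rightarrow> 'w set \<Rightarrow> ('w \<Rightarrow> 'g) \<Rightarrow> 'd \<times> 'w \<Rightarrow> 'd \<times> 'w" where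
  "fibrewise_act act \<Delta> W f = (\<lambda>(\<delta>, w)\<in>\<Delta> \<times> W. (act (f w) \<delta>, w))"

text \<open>The kernel of \<open>\<mu>\<^sub>F\<close> viewed inside the power \<open>G\<^sup>W\<close>.\<close>

definition cover_kernel ::
    "('g, 'b) monoid_scheme \<Rightarrow> ('g \<Rightarrow> 'd \<Rightarrow> 'd) \<Rightarrow> 'd set \<Rightarrow> 'w set
      \<Rightarrow> ('d \<times> 'w \<Rightarrow> 'd \<times> 'w) set \<Rightarrow> ('w \<Rightarrow> 'g) set" where
  "cover_kernel G act \<Delta> W F =
    {f \<in> carrier (power_group G W). fibrewise_act act \<Delta> W f \<in> Ker_mu \<Delta> W F}"

definition cover_kernels ::
    "('g, 'b) monoid_scheme \<Rightarrow> ('g \<Rightarrow> 'd \<Rightarrow> 'd) \<Rightarrow> 'd set \<Rightarrow> 'w set \<Rightarrow> ('w \<Rightarrow> 'w) set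
      \<Rightarrow> ('w \<Rightarrow> 'g) set set" where
  "cover_kernels G act \<Delta> W \<Upsilon> = cover_kernel G act \<Delta> W ` cover_groups G act \<Delta> W \<Upsilon>"

definition cover_isomorphic ::
    "'d set \<Rightarrow> 'w set \<Rightarrow> ('d \<times> 'w \<Rightarrow> 'd \<times> 'w) set \<Rightarrow> ('d \<times> 'w \<Rightarrow> 'd \<times> 'w) set \<Rightarrow> bool" where
  "cover_isomorphic \<Delta> W F1 F2 \<longleftrightarrow>
    (\<exists>\<phi>\<in>Bij (\<Delta> \<times> W). (\<forall>w\<in>W. \<phi> ` fibre \<Delta> W w = fibre \<Delta> W w) \<and>
      (\<lambda>g. \<phi> \<otimes>\<^bsub>BijGroup (\<Delta> \<times> W)\<^esub> g \<otimes>\<^bsub>BijGroup (\<Delta> \<times> W)\<^esub> inv\<^bsub>BijGroup (\<Delta> \<times> W)\<^esub> \<phi>) ` F1 = F2)"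

text \<open>Non-isomorphic groups can have the same kernel (for \<open>G = A\<^sub>5\<close> and \<open>W\<close> of size two, both
  \<open>S\<^sub>5\<close> and \<open>A\<^sub>5 \<times> C\<^sub>2\<close> occur with the diagonal kernel), so two kernels are related
  iff they are the kernels of \<^emph>\<open>some\<close> pair of isomorphic groups.\<close>

definition kernel_rel ::
    "('g, 'b) monoid_scheme \<Rightarrow> ('g \<Rightarrow> 'd \<Rightarrow> 'd) \<Rightarrow> 'd set \<Rightarrow> 'w set \<Rightarrow> ('w \<Rightarrow> 'w) set
      \<Rightarrow> (('w \<Rightarrow> 'g) set \<times> ('w \<Rightarrow> 'g) set) set" where
  "kernel_rel G act \<Delta> W \<Upsilon> =
    {(cover_kernel G act \<Delta> W F1, cover_kernel G act \<Delta> W F2) | F1 F2.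
      F1 \<in> cover_groups G act \<Delta> W \<Upsilon> \<and> F2 \<in> cover_groups G act \<Delta> W \<Upsilon> \<and>
      cover_isomorphic \<Delta> W F1 F2}"

definition congruences :: "'w set \<Rightarrow> ('w \<Rightarrow> 'w) set \<Rightarrow> ('w \<times> 'w) set set" where
  "congruences W \<Upsilon> = {\<rho>. equiv W \<rho> \<and> (\<forall>g\<in>\<Upsilon>. \<forall>(x, y)\<in>\<rho>. (g x, g y) \<in> \<rho>)}"

definition K_of :: "('g, 'b) monoid_scheme \<Rightarrow> 'w set \<Rightarrow> ('w \<times> 'w) set \<Rightarrow> ('w \<Rightarrow> 'g) set" where
  "K_of G W \<rho> = {f \<in> carrier (power_group G W). \<forall>C\<in>W // \<rho>. f constant_on C}"

definition K_at ::
    "('g, 'b) monoid_scheme \<Rightarrow> ('w \<Rightarrow> 'g) set \<Rightarrow> 'w list \<Rightarrow> ('w \<Rightarrow> 'g) monoid" where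
  "K_at G K ws = power_group G (set ws)\<lparr>carrier := (\<lambda>f. restrict f (set ws)) ` K\<rparr>"

definition rho_of :: "('g, 'b) monoid_scheme \<Rightarrow> 'w set \<Rightarrow> ('w \<Rightarrow> 'g) set \<Rightarrow> ('w \<times> 'w) set" where
  "rho_of G W K = {(x, y) \<in> W \<times> W. K_at G K [x, y] \<cong> G}"

end

theory Submission
  imports Defs
begin

text \<open>
  For \<open>K \<in> \<K>\<close>, all coordinate projections are onto the finite group \<open>G\<close>, so \<open>K(x, y) \<cong> G\<close> iff
  \<open>f x = 1\<close> implies \<open>f y = 1\<close> for all \<open>f \<in> K\<close>. This form of \<open>\<rho>\<^sub>K\<close> is visibly invariant under
  conjugation.

  As \<open>G\<close> is simple and non-abelian, \<open>K\<close> restricts onto \<open>G\<^sup>T\<close> for every finite set \<open>T\<close> of pairwise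
  \<open>\<rho>\<^sub>K\<close>-inequivalent points: commutators of elements that vanish on complementary parts of
  \<open>T - {s}\<close> yield elements of \<open>K\<close> supported on \<open>s\<close> within \<open>T\<close>. Since \<open>K\<close> is closed, it consists of
  all functions whose value at \<open>w\<close> is the image, under an automorphism depending only on \<open>w\<close>, of the
  value at a representative of the \<open>\<rho>\<^sub>K\<close>-class of \<open>w\<close>. As \<open>G\<close> is regular, these automorphisms are
  induced by permutations of \<open>\<Delta>\<close> normalizing \<open>G\<close>; conjugating fibrewise by them carries \<open>K\<close> to
  \<open>K\<^sub>\<rho>\<close> with \<open>\<rho> = \<rho>\<^sub>K\<close>. Conversely, \<open>K\<^sub>\<rho>\<close> is the kernel of the closed group \<open>K\<^sub>\<rho> \<rtimes> \<Upsilon>\<close>.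
\<close>

subsection \<open>Closed sets of permutations\<close>

lemma topspace_Sym_topology: "topspace (Sym_topology S) = Bij S"
  unfolding Sym_topology_def
  by (auto simp: PiE_def dest: Bij_imp_funcset Bij_imp_extensional)

text \<open>Basic open sets of a product of discrete spaces restrict finitely many coordinates. So
  the closure of \<open>H\<close> in \<open>Bij S\<close> consists of the permutations that agree
  with some element of \<open>H\<close> on each finite set, and all later topology is done with this
  criterion.\<close>

lemma closedin_Sym_topology_iff:
  "closedin (Sym_topology S) H \<longleftrightarrow>
    H \<subseteq> Bij S \<and> (\<forall>g\<in>Bij S. (\<forall>T. finite T \<and> T \<subseteq> S \<longrightarrow> (\<exists>h\<in>H. \<forall>t\<in>T. h t = g t)) \<longrightarrow> g \<in> H)"
proof -
  have cl: "g \<in> (Sym_topology S closure_of H) \<longleftrightarrow>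
      (\<forall>T. finite T \<and> T \<subseteq> S \<longrightarrow> (\<exists>h\<in>H. \<forall>t\<in>T. h t = g t))"
    if H: "H \<subseteq> Bij S" and g: "g \<in> Bij S" for g
  proof (intro iffI allI impI)
    fix T assume L: "g \<in> (Sym_topology S closure_of H)" and T: "finite T \<and> T \<subseteq> S"
    \<comment> \<open>The box that pins \<open>g\<close> on \<open>T\<close> and leaves the other
      coordinates free.\<close>
    define U where "U i = (if i \<in> T then {g i} else S)" for i
    have "finite {i \<in> S. U i \<noteq> S}"
      by (rule finite_subset [of _ T]) (use T in \<open>auto simp: U_def\<close>)
    moreover have U: "\<forall>i\<in>S. U i \<subseteq> S"
      using g by (auto simp: U_def dest: Bij_imp_funcset)
    ultimately have "openin (product_topology (\<lambda>_. discrete_topology S) S) (PiE S U)"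
      unfolding openin_product_topology_alt by (auto intro!: exI[of _ U])
    then have "openin (Sym_topology S) (Bij S \<inter> PiE S U)"
      unfolding Sym_topology_def by (metis inf_commute openin_subtopology)
    moreover have "g \<in> Bij S \<inter> PiE S U"
      using g Bij_imp_funcset[OF g] Bij_imp_extensional[OF g] by (auto simp: U_def PiE_def)
    ultimately obtain h where "h \<in> H" "h \<in> PiE S U"
      using L unfolding in_closure_of by blast
    then show "\<exists>h\<in>H. \<forall>t\<in>T. h t = g t"
      using T by (auto simp: U_def PiE_iff split: if_splits)
  next
    assume R: "\<forall>T. finite T \<and> T \<subseteq> S \<longrightarrow> (\<exists>h\<in>H. \<forall>t\<in>T. h t = g t)"
    show "g \<in> (Sym_topology S closure_of H)"
      unfolding in_closure_of
    proof (intro conjI allI impI)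
      show "g \<in> topspace (Sym_topology S)"
        using g by (simp add: topspace_Sym_topology)
      fix O' assume O': "g \<in> O' \<and> openin (Sym_topology S) O'"
      then obtain V where V: "openin (product_topology (\<lambda>_. discrete_topology S) S) V"
        and OV: "O' = V \<inter> Bij S"
        unfolding Sym_topology_def openin_subtopology by auto
      have "g \<in> V" using O' OV by blast
      obtain U where U: "finite {i \<in> S. U i \<noteq> S}" "g \<in> PiE S U" "PiE S U \<subseteq> V"
        using V[unfolded openin_product_topology_alt topspace_discrete_topology, rule_format, OF \<open>g \<in> V\<close>]
        by (elim exE conjE that)
      \<comment> \<open>Only finitely many coordinates of the box are restricted, and agreement with
        \<open>g\<close> on them already puts \<open>h\<close> into it.\<close>
      obtain h where h: "h \<in> H" "\<forall>t\<in>{i \<in> S. U i \<noteq> S}. h t = g t"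
        using R[rule_format, of "{i \<in> S. U i \<noteq> S}"] U(1) by auto
      have "h \<in> Bij S" using h H by auto
      moreover have "h \<in> PiE S U"
      proof (rule PiE_I)
        fix i assume "i \<in> S"
        then show "h i \<in> U i"
          using h U(2) Bij_imp_funcset[OF \<open>h \<in> Bij S\<close>]
          by (cases "U i = S") (auto simp: PiE_iff)
      next
        fix i assume "i \<notin> S"
        then show "h i = undefined"
          using extensional_arb[OF Bij_imp_extensional[OF \<open>h \<in> Bij S\<close>]] by simp
      qed
      ultimately show "\<exists>y. y \<in> H \<and> y \<in> O'"
        using h OV U(3) by auto
    qed
  qed
  show ?thesis
  proof (cases "H \<subseteq> Bij S")
    case True
    then have "closedin (Sym_topology S) H \<longleftrightarrow> Sym_topology S closure_of H \<subseteq> H"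
      by (metis closure_of_subset_eq topspace_Sym_topology)
    also have "\<dots> \<longleftrightarrow> (\<forall>g\<in>Bij S. g \<in> (Sym_topology S closure_of H) \<longrightarrow> g \<in> H)"
      using closure_of_subset_topspace[of "Sym_topology S" H] by (auto simp: topspace_Sym_topology)
    finally show ?thesis
      using True cl[OF True] by auto
  next
    case False
    then show ?thesis
      by (metis closedin_subset topspace_Sym_topology)
  qed
qed

lemma closedin_Sym_topologyI:
  assumes "H \<subseteq> Bij S"
    and "\<And>g. g \<in> Bij S \<Longrightarrow> (\<And>T. finite T \<Longrightarrow> T \<subseteq> S \<Longrightarrow> \<exists>h\<in>H. \<forall>t\<in>T. h t = g t) \<Longrightarrow> g \<in> H"
  shows "closedin (Sym_topology S) H"
  unfolding closedin_Sym_topology_iff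
proof (intro conjI ballI impI)
  fix g assume "g \<in> Bij S" "\<forall>T. finite T \<and> T \<subseteq> S \<longrightarrow> (\<exists>h\<in>H. \<forall>t\<in>T. h t = g t)"
  then show "g \<in> H" by (intro assms(2)) simp_all
qed (rule assms(1))

lemma closedin_Sym_topologyD:
  assumes "closedin (Sym_topology S) H" "g \<in> Bij S"
    and "\<And>T. finite T \<Longrightarrow> T \<subseteq> S \<Longrightarrow> \<exists>h\<in>H. \<forall>t\<in>T. h t = g t"
  shows "g \<in> H"
  using assms unfolding closedin_Sym_topology_iff by simp

subsection \<open>Subdirect subgroups of powers\<close>

text \<open>\<open>K_at\<close> sees the list of points only through its set, so both orders give
  the same group.\<close>

lemma rho_of_sym: "(x, y) \<in> rho_of G W K \<Longrightarrow> (y, x) \<in> rho_of G W K"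
  by (simp add: rho_of_def K_at_def insert_commute)

text \<open>Isolates the algebraic properties of a kernel inside \<open>G^W\<close>, free of
  topology and of the action on \<open>\<Delta>\<close>; instantiated by
  \<open>subdirect_cover_kernel\<close>.\<close>

locale subdirect_power =
  fixes G :: "('g, 'b) monoid_scheme" (structure) and W :: "'w set" and K :: "('w \<Rightarrow> 'g) set"
  assumes group_G: "group G"
    and subgroup_K: "subgroup K (power_group G W)"
    and subdirect: "w \<in> W \<Longrightarrow> a \<in> carrier G \<Longrightarrow> \<exists>k\<in>K. k w = a"
begin

text \<open>The working form of \<open>rho_of\<close>, in terms of the places where elements are
  trivial. It is not visibly symmetric; for finite \<open>G\<close> symmetry follows through
  \<open>rho_of_iff\<close>.\<close>

definition determines :: "'w \<Rightarrow> 'w \<Rightarrow> bool" where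
  "determines x y \<longleftrightarrow> (\<forall>k\<in>K. k x = \<one> \<longrightarrow> k y = \<one>)"

sublocale group G by (rule group_G)

lemma K_mem: "k \<in> K \<Longrightarrow> w \<in> W \<Longrightarrow> k w \<in> carrier G"
  using subgroup.subset[OF subgroup_K] by (auto simp: PiE_iff)

lemma K_PiE: "k \<in> K \<Longrightarrow> k \<in> (\<Pi>\<^sub>E w\<in>W. carrier G)"
  using subgroup.subset[OF subgroup_K] by auto

lemma K_one: "(\<lambda>w\<in>W. \<one>) \<in> K"
  using subgroup.one_closed[OF subgroup_K] by simp

lemma K_mult: "k \<in> K \<Longrightarrow> l \<in> K \<Longrightarrow> (\<lambda>w\<in>W. k w \<otimes> l w) \<in> K"
  using subgroup.m_closed[OF subgroup_K] by simp

lemma K_inv: "k \<in> K \<Longrightarrow> (\<lambda>w\<in>W. inv (k w)) \<in> K"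
  using subgroup.m_inv_closed[OF subgroup_K, of k] K_PiE[of k] by simp

text \<open>Apply the definition to the pointwise quotient of \<open>k\<close> and \<open>l\<close>,
  which lies in \<open>K\<close> and is trivial at \<open>x\<close>.\<close>

lemma determines_eq:
  assumes "determines x y" "x \<in> W" "y \<in> W" "k \<in> K" "l \<in> K" "k x = l x"
  shows "k y = l y"
proof -
  have "(\<lambda>w\<in>W. k w \<otimes> inv (l w)) \<in> K"
    using K_mult[OF assms(4) K_inv[OF assms(5)]] by (simp cong: restrict_cong)
  with assms have "k y \<otimes> inv (l y) = \<one>"
    unfolding determines_def by (metis K_mem r_inv restrict_apply')
  then show ?thesis
    using assms K_mem by (metis inv_closed inv_equality inv_inv)
qed

text \<open>A conjugating element of \<open>G\<close> lifts to \<open>K\<close>, because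
  \<open>K\<close> projects onto \<open>G\<close> at \<open>s\<close>. Conjugating by the lift keeps
  triviality on \<open>T\<close>.\<close>

lemma normal_projection:
  assumes "s \<in> W" "T \<subseteq> W"
  shows "{k s | k. k \<in> K \<and> (\<forall>t\<in>T. k t = \<one>)} \<lhd> G"
proof (rule normal_invI)
  let ?N = "{k s | k. k \<in> K \<and> (\<forall>t\<in>T. k t = \<one>)}"
  show "subgroup ?N G"
  proof (rule subgroupI)
    show "?N \<subseteq> carrier G" using K_mem assms by auto
    have "\<one> \<in> ?N"
      using K_one assms by (intro CollectI exI[of _ "\<lambda>w\<in>W. \<one>"]) auto
    then show "?N \<noteq> {}" by blast
  next
    fix a assume "a \<in> ?N"
    then obtain k where k: "a = k s" "k \<in> K" "\<forall>t\<in>T. k t = \<one>" by auto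
    then show "inv a \<in> ?N"
      using K_inv[OF k(2)] assms
      by (intro CollectI exI[of _ "\<lambda>w\<in>W. inv (k w)"]) auto
  next
    fix a b assume "a \<in> ?N" "b \<in> ?N"
    then obtain k l where k: "a = k s" "k \<in> K" "\<forall>t\<in>T. k t = \<one>"
      and l: "b = l s" "l \<in> K" "\<forall>t\<in>T. l t = \<one>" by auto
    then show "a \<otimes> b \<in> ?N"
      using K_mult[OF k(2) l(2)] assms
      by (intro CollectI exI[of _ "\<lambda>w\<in>W. k w \<otimes> l w"]) auto
  qed
  fix a b assume "a \<in> carrier G" "b \<in> ?N"
  then obtain k l where k: "a = k s" "k \<in> K" and l: "b = l s" "l \<in> K" "\<forall>t\<in>T. l t = \<one>"
    using subdirect[OF assms(1), of a] by blast
  have "(\<lambda>w\<in>W. k w \<otimes> l w \<otimes> inv (k w)) \<in> K"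
    using K_mult[OF K_mult[OF k(2) l(2)] K_inv[OF k(2)]] by (simp cong: restrict_cong)
  then show "a \<otimes> b \<otimes> inv a \<in> ?N"
    using k l assms K_mem[OF k(2)]
    by (intro CollectI exI[of _ "\<lambda>w\<in>W. k w \<otimes> l w \<otimes> inv (k w)"]) auto
qed

text \<open>Evaluation at \<open>x\<close> maps \<open>K(x, y)\<close> homomorphically onto
  \<open>G\<close>, and it is injective exactly when the value at \<open>x\<close> determines the
  value at \<open>y\<close>.\<close>

lemma rho_of_iff:
  assumes "finite (carrier G)"
  shows "(x, y) \<in> rho_of G W K \<longleftrightarrow> x \<in> W \<and> y \<in> W \<and> determines x y"
proof -
  have "K_at G K [x, y] \<cong> G \<longleftrightarrow> determines x y" if xy: "x \<in> W" "y \<in> W"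
  proof -
    define C where "C = (\<lambda>f. restrict f {x, y}) ` K"
    have carr: "carrier (K_at G K [x, y]) = C"
      by (simp add: K_at_def C_def)
    have surj: "(\<lambda>f. f x) ` C = carrier G"
      using subdirect[OF xy(1)] K_mem xy(1) by (force simp: C_def image_image)
    show ?thesis
    proof
      assume "K_at G K [x, y] \<cong> G"
      then obtain h where "bij_betw h C (carrier G)"
        unfolding is_iso_def iso_def carr by auto
      \<comment> \<open>The given isomorphism may have nothing to do with evaluation at
        \<open>x\<close>, so only its cardinality statement is kept: a surjection between finite
        sets of equal size is injective.\<close>
      then have "finite C" "card C = card (carrier G)"
        using assms bij_betw_finite bij_betw_same_card by blast+
      then have inj: "inj_on (\<lambda>f. f x) C"
        using surj by (intro eq_card_imp_inj_on) auto
      show "determines x y"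
        unfolding determines_def
      proof (intro ballI impI)
        fix k assume k: "k \<in> K" "k x = \<one>"
        have "restrict k {x, y} = restrict (\<lambda>w\<in>W. \<one>) {x, y}"
        proof (rule inj_onD[OF inj])
          show "restrict k {x, y} \<in> C" "restrict (\<lambda>w\<in>W. \<one>) {x, y} \<in> C"
            unfolding C_def using k K_one by blast+
        qed (use k xy in simp)
        then show "k y = \<one>"
          using xy by (metis insertCI restrict_apply')
      qed
    next
      assume det: "determines x y"
      have "inj_on (\<lambda>f. f x) C"
      proof (rule inj_onI)
        fix f f' assume "f \<in> C" "f' \<in> C" and e: "f x = f' x"
        then obtain k k' where k: "k \<in> K" "k' \<in> K" "f = restrict k {x, y}" "f' = restrict k' {x, y}"
          by (auto simp: C_def)
        then have "k y = k' y" "k x = k' x"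
          using determines_eq[OF det xy] e by auto
        then show "f = f'"
          using k by (auto intro!: ext)
      qed
      moreover have "(\<lambda>f. f x) \<in> hom (K_at G K [x, y]) G"
        using K_mem xy by (auto simp: hom_def K_at_def)
      ultimately have "(\<lambda>f. f x) \<in> iso (K_at G K [x, y]) G"
        using surj by (auto simp: iso_def carr bij_betw_def)
      then show "K_at G K [x, y] \<cong> G"
        by (rule is_isoI)
    qed
  qed
  then show ?thesis
    by (auto simp: rho_of_def)
qed

text \<open>Symmetry is clear for \<open>rho_of\<close>, reflexivity and transitivity for
  \<open>determines\<close>; \<open>rho_of_iff\<close> combines them.\<close>

lemma equiv_rho_of:
  assumes "finite (carrier G)"
  shows "equiv W (rho_of G W K)"
proof (rule equivI)
  show "rho_of G W K \<subseteq> W \<times> W" by (auto simp: rho_of_def)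
  show "refl_on W (rho_of G W K)"
    by (auto intro!: refl_onI simp: rho_of_iff[OF assms] determines_def)
  show "sym (rho_of G W K)"
    by (auto intro: symI rho_of_sym)
  show "trans (rho_of G W K)"
    by (rule transI) (auto simp: rho_of_iff[OF assms] determines_def)
qed

end

locale simple_subdirect_power = subdirect_power +
  assumes simple: "simple_group G" and nonabelian: "\<not> comm_group G"
begin

text \<open>The elements of \<open>K\<close> trivial on \<open>T\<close> project to a normal subgroup of \<open>G\<close> at \<open>s\<close>. It is
  non-trivial because it contains all commutators of elements trivial on one part of \<open>T\<close> with
  elements trivial on the rest.\<close>

lemma separating_element:
  assumes "finite T" "T \<subseteq> W" "s \<in> W" "\<And>t. t \<in> T \<Longrightarrow> \<not> determines t s" "a \<in> carrier G"
  shows "\<exists>k\<in>K. k s = a \<and> (\<forall>t\<in>T. k t = \<one>)"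
  using assms(1,2,4,5)
proof (induction T arbitrary: a)
  case empty
  then show ?case using subdirect[OF assms(3)] by simp
next
  case (insert t T)
  \<comment> \<open>Simplicity turns one nontrivial value at \<open>s\<close> into all values: the
    values at \<open>s\<close> of elements trivial on \<open>U\<close> form a normal subgroup, hence
    all of \<open>G\<close>.\<close>
  have *: "\<exists>k\<in>K. k s = b \<and> (\<forall>u\<in>U. k u = \<one>)"
    if U: "U \<subseteq> W" and l: "l \<in> K" "\<forall>u\<in>U. l u = \<one>" "l s \<noteq> \<one>" and b: "b \<in> carrier G"
    for l U b
  proof -
    have "l s \<in> {k s | k. k \<in> K \<and> (\<forall>u\<in>U. k u = \<one>)}"
      using l by blast
    with l(3) have "{k s | k. k \<in> K \<and> (\<forall>u\<in>U. k u = \<one>)} = carrier G"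
      using simple_group.no_real_normal_subgroup[OF simple normal_projection[OF assms(3) U]]
      by (metis (no_types, lifting) singletonD)
    with b have "b \<in> {k s | k. k \<in> K \<and> (\<forall>u\<in>U. k u = \<one>)}" by simp
    then show ?thesis by blast
  qed
  obtain l where l: "l \<in> K" "l t = \<one>" "l s \<noteq> \<one>"
    using insert.prems(2)[of t] unfolding determines_def by auto
  have t: "\<exists>k\<in>K. k s = b \<and> k t = \<one>" if "b \<in> carrier G" for b
    using *[of "{t}" l b] insert.prems(1) that l by simp
  obtain b c where bc: "b \<in> carrier G" "c \<in> carrier G" "b \<otimes> c \<noteq> c \<otimes> b"
    using nonabelian group_comm_groupI by blast
  obtain k where k: "k \<in> K" "k s = b" "\<forall>u\<in>T. k u = \<one>"
    using insert.IH[of b] insert.prems bc(1) by auto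
  obtain m where m: "m \<in> K" "m s = c" "m t = \<one>"
    using t bc by blast
  \<comment> \<open>On \<open>T\<close> the factor \<open>k\<close> is trivial and at
    \<open>t\<close> the factor \<open>m\<close> is, so the commutator is trivial on
    \<open>insert t T\<close>. At \<open>s\<close> it is the commutator of \<open>b\<close> and
    \<open>c\<close>, which were chosen not to commute.\<close>
  let ?c = "\<lambda>w\<in>W. k w \<otimes> m w \<otimes> inv (k w) \<otimes> inv (m w)"
  have "?c \<in> K"
    using K_mult[OF K_mult[OF K_mult[OF k(1) m(1)] K_inv[OF k(1)]] K_inv[OF m(1)]]
    by (simp cong: restrict_cong)
  moreover have "\<forall>u\<in>insert t T. ?c u = \<one>"
    using k m insert.prems(1) K_mem[OF k(1)] K_mem[OF m(1)] by auto
  moreover have "?c s \<noteq> \<one>"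
  proof
    assume "?c s = \<one>"
    then have "(b \<otimes> c) \<otimes> inv (c \<otimes> b) = \<one>"
      using assms(3) k m bc by (simp add: m_assoc inv_mult_group)
    then show False
      using bc by (metis inv_closed inv_equality inv_inv m_closed)
  qed
  ultimately show ?case
    using *[OF insert.prems(1)] insert.prems(3) by blast
qed

text \<open>Induction on \<open>T\<close>: an element correct on \<open>T\<close> is repaired at the
  new point \<open>s\<close> by a factor from \<open>separating_element\<close>. That factor is
  trivial on \<open>T\<close>, so the earlier values survive.\<close>

lemma interpolating_element:
  assumes "finite T" "T \<subseteq> W" "\<And>s t. s \<in> T \<Longrightarrow> t \<in> T \<Longrightarrow> s \<noteq> t \<Longrightarrow> \<not> determines s t"
    and "\<And>t. t \<in> T \<Longrightarrow> h t \<in> carrier G"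
  shows "\<exists>k\<in>K. \<forall>t\<in>T. k t = h t"
  using assms
proof (induction T)
  case empty
  then show ?case using K_one by auto
next
  case (insert s T)
  then obtain k where k: "k \<in> K" "\<forall>t\<in>T. k t = h t" by blast
  have s: "s \<in> W" "k s \<in> carrier G" "h s \<in> carrier G"
    using insert.prems k(1) K_mem by auto
  have "\<exists>l\<in>K. l s = inv (k s) \<otimes> h s \<and> (\<forall>t\<in>T. l t = \<one>)"
    by (rule separating_element) (use insert s in auto)
  then obtain l where l: "l \<in> K" "l s = inv (k s) \<otimes> h s" "\<forall>t\<in>T. l t = \<one>" by blast
  show ?case
  proof (rule bexI[OF _ K_mult[OF k(1) l(1)]], rule ballI)
    fix t assume "t \<in> insert s T"
    then show "(\<lambda>w\<in>W. k w \<otimes> l w) t = h t"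
      using insert.prems k l s K_mem[OF k(1)]
      by (auto simp: m_assoc[symmetric])
  qed
qed

end

subsection \<open>Conjugation in symmetric groups\<close>

lemma BijGroup_carrier [simp]: "carrier (BijGroup S) = Bij S"
  by (simp add: BijGroup_def)

lemma BijGroup_one [simp]: "\<one>\<^bsub>BijGroup S\<^esub> = (\<lambda>x\<in>S. x)"
  by (simp add: BijGroup_def)

lemma BijGroup_mult_apply:
  "g \<in> Bij S \<Longrightarrow> h \<in> Bij S \<Longrightarrow> x \<in> S \<Longrightarrow> (g \<otimes>\<^bsub>BijGroup S\<^esub> h) x = g (h x)"
  by (simp add: BijGroup_def compose_def)

lemma Bij_mem: "g \<in> Bij S \<Longrightarrow> x \<in> S \<Longrightarrow> g x \<in> S"
  using Bij_imp_funcset by blast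

lemma Bij_inj: "g \<in> Bij S \<Longrightarrow> x \<in> S \<Longrightarrow> y \<in> S \<Longrightarrow> g x = g y \<longleftrightarrow> x = y"
  by (auto simp: Bij_def bij_betw_def dest: inj_onD)

lemma Bij_surjE:
  assumes "g \<in> Bij S" "y \<in> S" obtains x where "x \<in> S" "y = g x"
  using assms by (auto simp: Bij_def bij_betw_def)

lemma Bij_eqI: "g \<in> Bij S \<Longrightarrow> h \<in> Bij S \<Longrightarrow> (\<And>x. x \<in> S \<Longrightarrow> g x = h x) \<Longrightarrow> g = h"
  using Bij_imp_extensional by (metis extensionalityI)

lemma BijI:
  assumes "g \<in> extensional S" "\<And>x. x \<in> S \<Longrightarrow> g x \<in> S"
    and "\<And>x y. x \<in> S \<Longrightarrow> y \<in> S \<Longrightarrow> g x = g y \<Longrightarrow> x = y"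
    and "\<And>y. y \<in> S \<Longrightarrow> \<exists>x\<in>S. g x = y"
  shows "g \<in> Bij S"
proof -
  have "g ` S = S" using assms(2,4) by blast
  then show ?thesis using assms(1,3) by (simp add: Bij_def bij_betw_def inj_on_def)
qed

lemma BijGroup_closed:
  "g \<in> Bij S \<Longrightarrow> h \<in> Bij S \<Longrightarrow> g \<otimes>\<^bsub>BijGroup S\<^esub> h \<in> Bij S"
  "g \<in> Bij S \<Longrightarrow> inv\<^bsub>BijGroup S\<^esub> g \<in> Bij S"
  using group.is_monoid[OF group_BijGroup, of S] group.inv_closed[OF group_BijGroup, of g S]
    monoid.m_closed[of "BijGroup S" g h] by auto

lemma BijGroup_inv_apply:
  assumes "g \<in> Bij S" "x \<in> S"
  shows "(inv\<^bsub>BijGroup S\<^esub> g) (g x) = x" "g ((inv\<^bsub>BijGroup S\<^esub> g) x) = x"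
  using assms by (auto simp: inv_BijGroup Bij_mem Bij_def bij_betw_def f_inv_into_f)

definition conj_Bij :: "'a set \<Rightarrow> ('a \<Rightarrow> 'a) \<Rightarrow> ('a \<Rightarrow> 'a) \<Rightarrow> 'a \<Rightarrow> 'a" where
  "conj_Bij S p g = p \<otimes>\<^bsub>BijGroup S\<^esub> g \<otimes>\<^bsub>BijGroup S\<^esub> inv\<^bsub>BijGroup S\<^esub> p"

lemma conj_Bij_closed: "p \<in> Bij S \<Longrightarrow> g \<in> Bij S \<Longrightarrow> conj_Bij S p g \<in> Bij S"
  by (simp add: conj_Bij_def BijGroup_closed)

lemma conj_Bij_apply:
  assumes "p \<in> Bij S" "g \<in> Bij S" "x \<in> S"
  shows "conj_Bij S p g (p x) = p (g x)"
  using assms by (simp add: conj_Bij_def BijGroup_closed BijGroup_mult_apply BijGroup_inv_apply Bij_mem)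

text \<open>Every point has the form \<open>p x\<close>, and at such points the conjugate is
  described without inverses. This is the usual way below to compute a conjugate.\<close>

lemma conj_Bij_eqI:
  assumes p: "p \<in> Bij S" and g: "g \<in> Bij S" and h: "h \<in> Bij S"
    and eq: "\<And>x. x \<in> S \<Longrightarrow> h (p x) = p (g x)"
  shows "conj_Bij S p g = h"
proof (rule Bij_eqI[OF conj_Bij_closed[OF p g] h])
  fix y assume "y \<in> S"
  then obtain x where "x \<in> S" "y = p x" by (rule Bij_surjE[OF p])
  then show "conj_Bij S p g y = h y"
    using conj_Bij_apply[OF p g] eq by simp
qed

lemma conj_Bij_mult:
  assumes p: "p \<in> Bij S" and q: "q \<in> Bij S" and g: "g \<in> Bij S"
  shows "conj_Bij S p (conj_Bij S q g) = conj_Bij S (p \<otimes>\<^bsub>BijGroup S\<^esub> q) g"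
proof (rule conj_Bij_eqI)
  have pq: "p \<otimes>\<^bsub>BijGroup S\<^esub> q \<in> Bij S" using p q by (rule BijGroup_closed)
  show "p \<in> Bij S" "conj_Bij S q g \<in> Bij S" "conj_Bij S (p \<otimes>\<^bsub>BijGroup S\<^esub> q) g \<in> Bij S"
    using assms pq by (auto intro: conj_Bij_closed)
  fix x assume "x \<in> S"
  with q obtain y where y: "y \<in> S" "x = q y" by (rule Bij_surjE)
  show "conj_Bij S (p \<otimes>\<^bsub>BijGroup S\<^esub> q) g (p x) = p (conj_Bij S q g x)"
    using conj_Bij_apply[OF pq g y(1)] conj_Bij_apply[OF q g y(1)] y Bij_mem[OF g y(1)]
    by (simp add: BijGroup_mult_apply[OF p q])
qed

lemma conj_Bij_inv:
  assumes "p \<in> Bij S" "g \<in> Bij S"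
  shows "conj_Bij S (inv\<^bsub>BijGroup S\<^esub> p) (conj_Bij S p g) = g"
    and "conj_Bij S p (conj_Bij S (inv\<^bsub>BijGroup S\<^esub> p) g) = g"
proof -
  have inv: "inv\<^bsub>BijGroup S\<^esub> p \<in> Bij S" using assms by (simp add: BijGroup_closed)
  have one: "conj_Bij S (\<lambda>x\<in>S. x) g = g"
    by (rule conj_Bij_eqI) (use assms in \<open>auto simp: id_Bij Bij_mem\<close>)
  show "conj_Bij S (inv\<^bsub>BijGroup S\<^esub> p) (conj_Bij S p g) = g"
    using conj_Bij_mult[OF inv assms] group.l_inv[OF group_BijGroup, of p S] one assms by simp
  show "conj_Bij S p (conj_Bij S (inv\<^bsub>BijGroup S\<^esub> p) g) = g"
    using conj_Bij_mult[OF assms(1) inv assms(2)] group.r_inv[OF group_BijGroup, of p S] one assms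
    by simp
qed

lemma conj_Bij_hom: "p \<in> Bij S \<Longrightarrow> group_hom (BijGroup S) (BijGroup S) (conj_Bij S p)"
proof (intro group_hom.intro group_hom_axioms.intro group_BijGroup homI; simp)
  assume p: "p \<in> Bij S"
  fix g h assume gh: "g \<in> Bij S" "h \<in> Bij S"
  then show "conj_Bij S p g \<in> Bij S"
    using p by (simp add: conj_Bij_closed)
  show "conj_Bij S p (g \<otimes>\<^bsub>BijGroup S\<^esub> h) = conj_Bij S p g \<otimes>\<^bsub>BijGroup S\<^esub> conj_Bij S p h"
    by (rule conj_Bij_eqI)
      (use p gh in \<open>auto simp: conj_Bij_closed BijGroup_closed BijGroup_mult_apply conj_Bij_apply Bij_mem\<close>)
qed

lemma conj_id: "p \<in> Bij S \<Longrightarrow> conj_Bij S p (\<lambda>x\<in>S. x) = (\<lambda>x\<in>S. x)"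
  by (rule conj_Bij_eqI) (auto simp: id_Bij Bij_mem)

lemma conj_image_mult:
  assumes "p \<in> Bij S" "q \<in> Bij S" "F \<subseteq> Bij S"
  shows "conj_Bij S p ` conj_Bij S q ` F = conj_Bij S (p \<otimes>\<^bsub>BijGroup S\<^esub> q) ` F"
  unfolding image_image using assms conj_Bij_mult by (intro image_cong) blast+

lemma conj_image_inv:
  assumes "p \<in> Bij S" "F \<subseteq> Bij S"
  shows "conj_Bij S (inv\<^bsub>BijGroup S\<^esub> p) ` conj_Bij S p ` F = F"
proof -
  have "(\<lambda>g. conj_Bij S (inv\<^bsub>BijGroup S\<^esub> p) (conj_Bij S p g)) ` F = (\<lambda>g. g) ` F"
    using conj_Bij_inv(1)[OF assms(1)] assms(2) by (intro image_cong) blast+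
  then show ?thesis by (simp add: image_image)
qed

text \<open>Conjugation by \<open>p\<close> is a homeomorphism with inverse conjugation by the
  inverse of \<open>p\<close>: approximating \<open>g\<close> on the image of \<open>T\<close> under
  \<open>p\<close> amounts to approximating the pulled back permutation on \<open>T\<close>.\<close>

lemma conj_Bij_closed_subgroup:
  assumes p: "p \<in> Bij S" and H: "closed_subgroup_Sym H S"
  shows "closed_subgroup_Sym (conj_Bij S p ` H) S"
proof -
  let ?q = "inv\<^bsub>BijGroup S\<^esub> p"
  have q: "?q \<in> Bij S" using p by (simp add: BijGroup_closed)
  have HS: "H \<subseteq> Bij S"
    using H by (auto simp: closed_subgroup_Sym_def closedin_Sym_topology_iff)
  have "g \<in> conj_Bij S p ` H"
    if g: "g \<in> Bij S"
      and approx: "\<And>T. finite T \<Longrightarrow> T \<subseteq> S \<Longrightarrow> \<exists>h\<in>conj_Bij S p ` H. \<forall>t\<in>T. h t = g t" for g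
  proof -
    have "\<exists>h\<in>H. \<forall>t\<in>T. h t = conj_Bij S ?q g t" if T: "finite T" "T \<subseteq> S" for T
    proof -
      have "finite (p ` T)" "p ` T \<subseteq> S" using T Bij_mem[OF p] by auto
      from approx[OF this] obtain h where h: "h \<in> H" "\<forall>t\<in>T. conj_Bij S p h (p t) = g (p t)"
        by auto
      have "h t = conj_Bij S ?q g t" if "t \<in> T" for t
      proof -
        have tS: "t \<in> S" "h \<in> Bij S" using that T h HS by auto
        have "conj_Bij S ?q g t = conj_Bij S ?q g (?q (p t))"
          using tS p by (simp add: BijGroup_inv_apply)
        also have "\<dots> = ?q (g (p t))"
          using conj_Bij_apply[OF q g] Bij_mem[OF p] tS by simp
        also have "\<dots> = ?q (p (h t))"
          using h(2) that conj_Bij_apply[OF p tS(2) tS(1)] by simp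
        finally show ?thesis
          using BijGroup_inv_apply[OF p] Bij_mem[OF tS(2,1)] by simp
      qed
      then show ?thesis using h(1) by blast
    qed
    then have "conj_Bij S ?q g \<in> H"
      using H conj_Bij_closed[OF q g]
      by (intro closedin_Sym_topologyD[of S H]) (simp_all add: closed_subgroup_Sym_def)
    then show ?thesis
      using conj_Bij_inv(2)[OF p g] by (metis imageI)
  qed
  moreover have "conj_Bij S p ` H \<subseteq> Bij S"
    using HS p by (auto simp: conj_Bij_closed)
  ultimately have "closedin (Sym_topology S) (conj_Bij S p ` H)"
    by (intro closedin_Sym_topologyI) simp_all
  then show ?thesis
    using H group_hom.subgroup_img_is_subgroup[OF conj_Bij_hom[OF p]]
    by (simp add: closed_subgroup_Sym_def)
qed

subsection \<open>Permutations lying over permutations of the base\<close>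

locale regular_cover =
  fixes G :: "('g, 'b) monoid_scheme" (structure) and act :: "'g \<Rightarrow> 'd \<Rightarrow> 'd"
    and \<Delta> :: "'d set" and W :: "'w set"
  assumes regular: "regular_action G \<Delta> act" and finite_\<Delta>: "finite \<Delta>"
begin

sublocale action: regular_action G \<Delta> act by (rule regular)

sublocale group G
  using action.group_hom by (simp add: group_hom_def)

lemma act_Bij: "a \<in> carrier G \<Longrightarrow> act a \<in> Bij \<Delta>"
  by (rule action.bij_prop0)

lemma act_mem: "a \<in> carrier G \<Longrightarrow> \<delta> \<in> \<Delta> \<Longrightarrow> act a \<delta> \<in> \<Delta>"
  by (metis action.element_image)

lemma act_mult:
  "a \<in> carrier G \<Longrightarrow> b \<in> carrier G \<Longrightarrow> \<delta> \<in> \<Delta> \<Longrightarrow> act (a \<otimes> b) \<delta> = act a (act b \<delta>)"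
  by (metis action.composition_rule)

lemma act_one: "\<delta> \<in> \<Delta> \<Longrightarrow> act \<one> \<delta> = \<delta>"
  by (metis action.id_eq_one restrict_apply')

text \<open>Freeness at a single point: \<open>inv b \<otimes> a\<close> stabilizes
  \<open>\<delta>\<close>.\<close>

lemma act_eq_iff:
  assumes "a \<in> carrier G" "b \<in> carrier G" "\<delta> \<in> \<Delta>"
  shows "act a \<delta> = act b \<delta> \<longleftrightarrow> a = b"
proof
  assume "act a \<delta> = act b \<delta>"
  then have "act (inv b \<otimes> a) \<delta> = \<delta>"
    using assms by (metis act_mult act_one inv_closed l_inv)
  then have "inv b \<otimes> a \<in> stabilizer G act \<delta>"
    using assms by (simp add: stabilizer_def)
  then have "inv b \<otimes> a = \<one>"
    using action.trivial_stabilizer[OF assms(3)] by simp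
  then show "a = b"
    using assms by (metis inv_closed inv_equality inv_inv)
qed simp

lemma act_fixed_iff: "a \<in> carrier G \<Longrightarrow> \<delta> \<in> \<Delta> \<Longrightarrow> act a \<delta> = \<delta> \<longleftrightarrow> a = \<one>"
  using act_eq_iff[of a \<one> \<delta>] act_one by simp

lemma fibre_eq: "w \<in> W \<Longrightarrow> fibre \<Delta> W w = \<Delta> \<times> {w}"
  by (auto simp: fibre_def)

lemma ex_point: obtains \<delta> where "\<delta> \<in> \<Delta>"
  using action.nonempty by blast

text \<open>\<open>mu\<close> is built with \<open>the_elem\<close>, which is meaningful only if
  each image fibre projects to one point. Recording a lift together with the base permutation lets
  products, inverses and conjugates be handled without unfolding \<open>mu\<close>.\<close>

definition covers :: "('d \<times> 'w \<Rightarrow> 'd \<times> 'w) \<Rightarrow> ('w \<Rightarrow> 'w) \<Rightarrow> bool" where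
  "covers g u \<longleftrightarrow> g \<in> Bij (\<Delta> \<times> W) \<and> u \<in> Bij W \<and> (\<forall>\<delta>\<in>\<Delta>. \<forall>w\<in>W. snd (g (\<delta>, w)) = u w)"

lemma coversD:
  assumes "covers g u"
  shows "g \<in> Bij (\<Delta> \<times> W)" "u \<in> Bij W" "\<delta> \<in> \<Delta> \<Longrightarrow> w \<in> W \<Longrightarrow> snd (g (\<delta>, w)) = u w"
  using assms by (auto simp: covers_def)

lemma covers_apply:
  assumes "covers g u" "\<delta> \<in> \<Delta>" "w \<in> W"
  shows "g (\<delta>, w) = (fst (g (\<delta>, w)), u w)" "fst (g (\<delta>, w)) \<in> \<Delta>" "u w \<in> W"
proof -
  show *: "g (\<delta>, w) = (fst (g (\<delta>, w)), u w)"
    using coversD(3)[OF assms] by (metis prod.collapse)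
  have "g (\<delta>, w) \<in> \<Delta> \<times> W"
    using Bij_mem[OF coversD(1)[OF assms(1)]] assms by blast
  then show "fst (g (\<delta>, w)) \<in> \<Delta>" "u w \<in> W"
    by (metis mem_Times_iff, metis * mem_Sigma_iff)
qed

lemma covers_image:
  assumes g: "covers g u" and w: "w \<in> W"
  shows "g ` fibre \<Delta> W w = fibre \<Delta> W (u w)"
proof -
  have uw: "u w \<in> W" using Bij_mem[OF coversD(2)[OF g] w] .
  have "g ` (\<Delta> \<times> {w}) = \<Delta> \<times> {u w}"
  proof
    show "g ` (\<Delta> \<times> {w}) \<subseteq> \<Delta> \<times> {u w}"
    proof
      fix x assume "x \<in> g ` (\<Delta> \<times> {w})"
      then obtain \<delta> where \<delta>: "\<delta> \<in> \<Delta>" "x = g (\<delta>, w)" by auto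
      then show "x \<in> \<Delta> \<times> {u w}"
        using covers_apply[OF g \<delta>(1) w] by (metis mem_Sigma_iff singletonI)
    qed
    show "\<Delta> \<times> {u w} \<subseteq> g ` (\<Delta> \<times> {w})"
    proof
      fix x assume x: "x \<in> \<Delta> \<times> {u w}"
      then have "x \<in> \<Delta> \<times> W" using uw by auto
      then obtain y where y: "y \<in> \<Delta> \<times> W" "x = g y"
        by (rule Bij_surjE[OF coversD(1)[OF g]])
      \<comment> \<open>A preimage of a point over \<open>u w\<close> must lie over
        \<open>w\<close>, because \<open>u\<close> is injective; hence the whole fibre over
        \<open>u w\<close> is reached.\<close>
      then have "u (snd y) = u w"
        using x coversD(3)[OF g, of "fst y" "snd y"] by auto
      then have "snd y = w"
        using Bij_inj[OF coversD(2)[OF g]] y w by auto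
      then show "x \<in> g ` (\<Delta> \<times> {w})"
        using y by (cases y) auto
    qed
  qed
  then show ?thesis
    using uw w by (simp add: fibre_eq)
qed

text \<open>The image fibre lies over the single point \<open>u w\<close> and is nonempty because
  \<open>\<Delta>\<close> is, so \<open>the_elem\<close> returns \<open>u w\<close>.\<close>

lemma covers_mu:
  assumes g: "covers g u"
  shows "mu \<Delta> W g = u"
proof (rule extensionalityI[where A = W])
  show "u \<in> extensional W" by (rule Bij_imp_extensional[OF coversD(2)[OF g]])
  show "mu \<Delta> W g \<in> extensional W" by (simp add: mu_def)
  fix w assume w: "w \<in> W"
  have "snd ` fibre \<Delta> W (u w) = {u w}"
    using action.nonempty Bij_mem[OF coversD(2)[OF g] w] by (auto simp: fibre_eq)
  then show "mu \<Delta> W g w = u w"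
    using w covers_image[OF g w] by (simp add: mu_def)
qed

lemma covers_mult:
  assumes g: "covers g u" and h: "covers h v"
  shows "covers (g \<otimes>\<^bsub>BijGroup (\<Delta> \<times> W)\<^esub> h) (u \<otimes>\<^bsub>BijGroup W\<^esub> v)"
  unfolding covers_def
proof (intro conjI ballI)
  show "g \<otimes>\<^bsub>BijGroup (\<Delta> \<times> W)\<^esub> h \<in> Bij (\<Delta> \<times> W)" "u \<otimes>\<^bsub>BijGroup W\<^esub> v \<in> Bij W"
    using coversD[OF g] coversD[OF h] by (auto intro: BijGroup_closed)
  fix \<delta> w assume \<delta>: "\<delta> \<in> \<Delta>" "w \<in> W"
  then show "snd ((g \<otimes>\<^bsub>BijGroup (\<Delta> \<times> W)\<^esub> h) (\<delta>, w)) = (u \<otimes>\<^bsub>BijGroup W\<^esub> v) w"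
    using coversD[OF g] coversD[OF h] covers_apply[OF h \<delta>]
    by (metis BijGroup_mult_apply mem_Sigma_iff)
qed

lemma covers_inv:
  assumes g: "covers g u"
  shows "covers (inv\<^bsub>BijGroup (\<Delta> \<times> W)\<^esub> g) (inv\<^bsub>BijGroup W\<^esub> u)"
  unfolding covers_def
proof (intro conjI ballI)
  show "inv\<^bsub>BijGroup (\<Delta> \<times> W)\<^esub> g \<in> Bij (\<Delta> \<times> W)" "inv\<^bsub>BijGroup W\<^esub> u \<in> Bij W"
    using coversD[OF g] by (auto intro: BijGroup_closed)
  fix \<delta> w assume "\<delta> \<in> \<Delta>" "w \<in> W"
  then have "(\<delta>, w) \<in> \<Delta> \<times> W" by simp
  then obtain y where y: "y \<in> \<Delta> \<times> W" "(\<delta>, w) = g y"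
    by (rule Bij_surjE[OF coversD(1)[OF g]])
  then have "w = u (snd y)"
    using coversD(3)[OF g, of "fst y" "snd y"] by (metis mem_Times_iff prod.collapse snd_conv)
  then show "snd ((inv\<^bsub>BijGroup (\<Delta> \<times> W)\<^esub> g) (\<delta>, w)) = (inv\<^bsub>BijGroup W\<^esub> u) w"
    using y coversD[OF g] by (simp add: BijGroup_inv_apply mem_Times_iff)
qed

lemma covers_conj:
  "covers p u \<Longrightarrow> covers g v \<Longrightarrow> covers (conj_Bij (\<Delta> \<times> W) p g) (conj_Bij W u v)"
  unfolding conj_Bij_def by (intro covers_mult covers_inv)

abbreviation fibrewise :: "('d \<times> 'w \<Rightarrow> 'd \<times> 'w) \<Rightarrow> bool" where
  "fibrewise g \<equiv> covers g (\<lambda>w\<in>W. w)"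

text \<open>The right side is the condition on bijections in \<open>cover_isomorphic\<close>, the
  left side describes kernels of \<open>mu\<close>; one predicate serves both purposes.\<close>

lemma fibrewise_iff:
  "fibrewise g \<longleftrightarrow> g \<in> Bij (\<Delta> \<times> W) \<and> (\<forall>w\<in>W. g ` fibre \<Delta> W w = fibre \<Delta> W w)"
    (is "?L \<longleftrightarrow> ?R")
proof
  assume ?L
  then show ?R using covers_image[of g "\<lambda>w\<in>W. w"] coversD(1) by simp
next
  assume ?R
  then have g: "g \<in> Bij (\<Delta> \<times> W)" "\<forall>w\<in>W. g ` fibre \<Delta> W w = fibre \<Delta> W w" by auto
  have "snd (g (\<delta>, w)) = w" if "\<delta> \<in> \<Delta>" "w \<in> W" for \<delta> w
  proof -
    have "g (\<delta>, w) \<in> g ` fibre \<Delta> W w"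
      using that by (intro imageI) (simp add: fibre_eq)
    then have "g (\<delta>, w) \<in> fibre \<Delta> W w"
      using g(2) that by blast
    then show ?thesis
      by (simp add: fibre_def)
  qed
  then show "fibrewise g"
    using g(1) by (simp add: covers_def id_Bij)
qed

lemma fibrewise_conj: "covers p u \<Longrightarrow> fibrewise g \<Longrightarrow> fibrewise (conj_Bij (\<Delta> \<times> W) p g)"
  using covers_conj[of p u g "\<lambda>w\<in>W. w"] conj_id[of u W] coversD(2) by simp

lemma covers_conj_fibrewise:
  assumes "fibrewise p" "covers g u"
  shows "covers (conj_Bij (\<Delta> \<times> W) p g) u"
proof -
  have "conj_Bij W (\<lambda>w\<in>W. w) u = u"
    by (rule conj_Bij_eqI) (use coversD(2)[OF assms(2)] in \<open>auto simp: id_Bij Bij_mem\<close>)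
  then show ?thesis using covers_conj[OF assms] by simp
qed

section \<open>Restriction to a single fibre and its behaviour under conjugation\<close>

definition part :: "('d \<times> 'w \<Rightarrow> 'd \<times> 'w) \<Rightarrow> 'w \<Rightarrow> 'd \<Rightarrow> 'd" where
  "part g w = (\<lambda>\<delta>\<in>\<Delta>. fst (g (\<delta>, w)))"

lemma induced_on_fibre_part:
  "induced_on_fibre \<Delta> W H w = (\<lambda>g. part g w) ` {g \<in> H. g ` fibre \<Delta> W w = fibre \<Delta> W w}"
  by (simp add: induced_on_fibre_def part_def)

lemma part_apply:
  assumes "g ` fibre \<Delta> W w = fibre \<Delta> W w" "w \<in> W" "\<delta> \<in> \<Delta>"
  shows "g (\<delta>, w) = (part g w \<delta>, w)"
proof -
  have "g (\<delta>, w) \<in> g ` fibre \<Delta> W w"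
    using assms by (intro imageI) (simp add: fibre_eq)
  then have "snd (g (\<delta>, w)) = w"
    unfolding assms(1) by (simp add: fibre_def)
  then show ?thesis using assms by (simp add: part_def prod_eq_iff)
qed

lemma part_Bij:
  assumes g: "g \<in> Bij (\<Delta> \<times> W)" and gw: "g ` fibre \<Delta> W w = fibre \<Delta> W w" and w: "w \<in> W"
  shows "part g w \<in> Bij \<Delta>"
proof (rule BijI)
  show "part g w \<in> extensional \<Delta>" by (simp add: part_def)
next
  fix \<delta> assume "\<delta> \<in> \<Delta>"
  then show "part g w \<delta> \<in> \<Delta>"
    using part_apply[OF gw w] Bij_mem[OF g, of "(\<delta>, w)"] w by simp
next
  fix \<delta> \<epsilon> assume "\<delta> \<in> \<Delta>" "\<epsilon> \<in> \<Delta>" "part g w \<delta> = part g w \<epsilon>"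
  then show "\<delta> = \<epsilon>"
    using part_apply[OF gw w] Bij_inj[OF g, of "(\<delta>, w)" "(\<epsilon>, w)"] w by simp
next
  fix \<delta> assume "\<delta> \<in> \<Delta>"
  then have "(\<delta>, w) \<in> g ` fibre \<Delta> W w"
    using gw w by (simp add: fibre_eq)
  then obtain \<epsilon> where "\<epsilon> \<in> \<Delta>" "(\<delta>, w) = g (\<epsilon>, w)"
    using w by (auto simp: fibre_eq)
  then show "\<exists>\<epsilon>\<in>\<Delta>. part g w \<epsilon> = \<delta>"
    using part_apply[OF gw w] by auto
qed

text \<open>As \<open>p\<close> maps the fibre onto itself, the conjugate sends the fibre to the
  \<open>p\<close>-image of its image under \<open>g\<close>; injectivity of \<open>p\<close>
  cancels the outer \<open>p\<close>.\<close>

lemma conj_stabilizes_fibre_iff: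
  assumes p: "fibrewise p" and g: "g \<in> Bij (\<Delta> \<times> W)" and w: "w \<in> W"
  shows "conj_Bij (\<Delta> \<times> W) p g ` fibre \<Delta> W w = fibre \<Delta> W w \<longleftrightarrow> g ` fibre \<Delta> W w = fibre \<Delta> W w"
proof -
  have pB: "p \<in> Bij (\<Delta> \<times> W)" and pw: "p ` fibre \<Delta> W w = fibre \<Delta> W w"
    using p w by (auto simp: fibrewise_iff)
  have sub: "fibre \<Delta> W w \<subseteq> \<Delta> \<times> W" by (auto simp: fibre_def)
  have "conj_Bij (\<Delta> \<times> W) p g ` fibre \<Delta> W w = conj_Bij (\<Delta> \<times> W) p g ` p ` fibre \<Delta> W w"
    by (simp add: pw)
  also have "\<dots> = p ` g ` fibre \<Delta> W w"
    using conj_Bij_apply[OF pB g] sub by (auto simp: image_image intro!: image_cong)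
  finally have "conj_Bij (\<Delta> \<times> W) p g ` fibre \<Delta> W w = p ` g ` fibre \<Delta> W w" .
  moreover have "p ` g ` fibre \<Delta> W w = p ` fibre \<Delta> W w \<longleftrightarrow> g ` fibre \<Delta> W w = fibre \<Delta> W w"
  proof (rule inj_on_image_eq_iff[where C = "\<Delta> \<times> W"])
    show "inj_on p (\<Delta> \<times> W)" using pB by (simp add: Bij_def bij_betw_def)
    show "g ` fibre \<Delta> W w \<subseteq> \<Delta> \<times> W" using sub Bij_mem[OF g] by blast
  qed (rule sub)
  ultimately show ?thesis by (simp add: pw)
qed

text \<open>Conjugation matches the setwise stabilizers of the fibre, and on them restriction to the
  fibre commutes with conjugation.\<close>

lemma induced_on_fibre_conj:
  assumes p: "fibrewise p" and H: "H \<subseteq> Bij (\<Delta> \<times> W)" and w: "w \<in> W"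
  shows "induced_on_fibre \<Delta> W (conj_Bij (\<Delta> \<times> W) p ` H) w =
    conj_Bij \<Delta> (part p w) ` induced_on_fibre \<Delta> W H w"
proof -
  let ?c = "conj_Bij (\<Delta> \<times> W) p"
  have pB: "p \<in> Bij (\<Delta> \<times> W)" and pw: "p ` fibre \<Delta> W w = fibre \<Delta> W w"
    using p w by (auto simp: fibrewise_iff)
  have stab: "{g \<in> ?c ` H. g ` fibre \<Delta> W w = fibre \<Delta> W w} = ?c ` {g \<in> H. g ` fibre \<Delta> W w = fibre \<Delta> W w}"
    using conj_stabilizes_fibre_iff[OF p _ w] H by blast
  have "part (?c g) w = conj_Bij \<Delta> (part p w) (part g w)"
    if g: "g \<in> H" "g ` fibre \<Delta> W w = fibre \<Delta> W w" for g
  proof (rule conj_Bij_eqI[symmetric])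
    have gB: "g \<in> Bij (\<Delta> \<times> W)" using g H by blast
    have cw: "?c g ` fibre \<Delta> W w = fibre \<Delta> W w"
      using conj_stabilizes_fibre_iff[OF p gB w] g by simp
    show "part p w \<in> Bij \<Delta>" "part g w \<in> Bij \<Delta>" "part (?c g) w \<in> Bij \<Delta>"
      using pB pw gB g cw w conj_Bij_closed[OF pB gB] by (auto intro: part_Bij)
    then have mem: "part p w \<delta> \<in> \<Delta>" "part g w \<delta> \<in> \<Delta>" if "\<delta> \<in> \<Delta>" for \<delta>
      using that Bij_mem by metis+
    fix \<delta> assume \<delta>: "\<delta> \<in> \<Delta>"
    have "?c g (p (\<delta>, w)) = p (g (\<delta>, w))"
      using conj_Bij_apply[OF pB gB] \<delta> w by simp
    then show "part (?c g) w (part p w \<delta>) = part p w (part g w \<delta>)"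
      using part_apply[OF pw w] part_apply[OF g(2) w] part_apply[OF cw w] \<delta> mem by simp
  qed
  then show ?thesis
    unfolding induced_on_fibre_part stab by (auto simp: image_image intro!: image_cong)
qed

text \<open>Elements of the unrestricted wreath product of \<open>G\<close> with
  \<open>Sym(W)\<close>: \<open>f w\<close> twists the fibre over \<open>w\<close>, then
  \<open>u\<close> moves it. The maps \<open>fibrewise_act\<close> are those with identity base
  component.\<close>

definition skew :: "('w \<Rightarrow> 'g) \<Rightarrow> ('w \<Rightarrow> 'w) \<Rightarrow> 'd \<times> 'w \<Rightarrow> 'd \<times> 'w" where
  "skew f u = (\<lambda>(\<delta>, w)\<in>\<Delta> \<times> W. (act (f w) \<delta>, u w))"

lemma skew_apply: "\<delta> \<in> \<Delta> \<Longrightarrow> w \<in> W \<Longrightarrow> skew f u (\<delta>, w) = (act (f w) \<delta>, u w)"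
  by (simp add: skew_def)

lemma fibrewise_act_eq_skew: "fibrewise_act act \<Delta> W f = skew f (\<lambda>w\<in>W. w)"
  by (auto simp: fibrewise_act_def skew_def intro!: restrict_ext)

lemma skew_covers:
  assumes f: "\<And>w. w \<in> W \<Longrightarrow> f w \<in> carrier G" and u: "u \<in> Bij W"
  shows "covers (skew f u) u"
proof -
  have "skew f u \<in> Bij (\<Delta> \<times> W)"
  proof (rule BijI)
    show "skew f u \<in> extensional (\<Delta> \<times> W)" by (simp add: skew_def)
  next
    fix x assume "x \<in> \<Delta> \<times> W"
    then show "skew f u x \<in> \<Delta> \<times> W"
      using f Bij_mem[OF u] by (auto simp: skew_apply act_mem)
  next
    fix x y assume xy: "x \<in> \<Delta> \<times> W" "y \<in> \<Delta> \<times> W" "skew f u x = skew f u y"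
    obtain \<delta> v where x: "x = (\<delta>, v)" "\<delta> \<in> \<Delta>" "v \<in> W" using xy by blast
    obtain \<epsilon> w where y: "y = (\<epsilon>, w)" "\<epsilon> \<in> \<Delta>" "w \<in> W" using xy by blast
    have "v = w" "act (f v) \<delta> = act (f w) \<epsilon>"
      using xy x y Bij_inj[OF u] by (auto simp: skew_apply)
    then show "x = y"
      using x y Bij_inj[OF act_Bij[OF f]] by simp
  next
    fix y assume y: "y \<in> \<Delta> \<times> W"
    then have "snd y \<in> W" "fst y \<in> \<Delta>" by auto
    obtain w where w: "w \<in> W" "snd y = u w"
      by (rule Bij_surjE[OF u \<open>snd y \<in> W\<close>])
    obtain \<delta> where "\<delta> \<in> \<Delta>" "fst y = act (f w) \<delta>"
      by (rule Bij_surjE[OF act_Bij[OF f[OF w(1)]] \<open>fst y \<in> \<Delta>\<close>])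
    then show "\<exists>x\<in>\<Delta> \<times> W. skew f u x = y"
      using w by (intro bexI[of _ "(\<delta>, w)"]) (simp_all add: skew_apply prod_eq_iff)
  qed
  then show ?thesis
    using u by (simp add: covers_def skew_apply)
qed

lemma fibrewise_act_fibrewise:
  "f \<in> carrier (power_group G W) \<Longrightarrow> fibrewise (fibrewise_act act \<Delta> W f)"
  unfolding fibrewise_act_eq_skew by (rule skew_covers) (auto simp: id_Bij)

lemma fibrewise_act_apply:
  "\<delta> \<in> \<Delta> \<Longrightarrow> w \<in> W \<Longrightarrow> fibrewise_act act \<Delta> W f (\<delta>, w) = (act (f w) \<delta>, w)"
  by (simp add: fibrewise_act_def)

lemma fibrewise_act_hom:
  "group_hom (power_group G W) (BijGroup (\<Delta> \<times> W)) (fibrewise_act act \<Delta> W)"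
proof (intro group_hom.intro group_hom_axioms.intro homI)
  show "group (power_group G W)" by (rule product_group) (rule group_axioms)
  show "group (BijGroup (\<Delta> \<times> W))" by (rule group_BijGroup)
  fix f assume f: "f \<in> carrier (power_group G W)"
  show fB: "fibrewise_act act \<Delta> W f \<in> carrier (BijGroup (\<Delta> \<times> W))"
    using fibrewise_act_fibrewise[OF f] coversD(1) by simp
  fix h assume h: "h \<in> carrier (power_group G W)"
  interpret P: group "power_group G W" by (rule product_group) (rule group_axioms)
  show "fibrewise_act act \<Delta> W (f \<otimes>\<^bsub>power_group G W\<^esub> h) =
      fibrewise_act act \<Delta> W f \<otimes>\<^bsub>BijGroup (\<Delta> \<times> W)\<^esub> fibrewise_act act \<Delta> W h"
  proof (rule Bij_eqI)
    show "fibrewise_act act \<Delta> W (f \<otimes>\<^bsub>power_group G W\<^esub> h) \<in> Bij (\<Delta> \<times> W)"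
      by (rule coversD(1)[OF fibrewise_act_fibrewise[OF P.m_closed[OF f h]]])
    have hB: "fibrewise_act act \<Delta> W h \<in> Bij (\<Delta> \<times> W)"
      by (rule coversD(1)[OF fibrewise_act_fibrewise[OF h]])
    show "fibrewise_act act \<Delta> W f \<otimes>\<^bsub>BijGroup (\<Delta> \<times> W)\<^esub> fibrewise_act act \<Delta> W h \<in> Bij (\<Delta> \<times> W)"
      using fB hB by (simp add: BijGroup_closed)
    fix x assume "x \<in> \<Delta> \<times> W"
    then obtain \<delta> w where x: "x = (\<delta>, w)" "\<delta> \<in> \<Delta>" "w \<in> W" by blast
    have "f w \<in> carrier G" "h w \<in> carrier G" using f h x by auto
    then show "fibrewise_act act \<Delta> W (f \<otimes>\<^bsub>power_group G W\<^esub> h) x =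
      (fibrewise_act act \<Delta> W f \<otimes>\<^bsub>BijGroup (\<Delta> \<times> W)\<^esub> fibrewise_act act \<Delta> W h) x"
      using x fB hB by (simp add: BijGroup_mult_apply fibrewise_act_apply act_mult act_mem)
  qed
qed

text \<open>Stated for any \<open>F\<close> whose elements cover something, so that it is available
  before \<open>F\<close> is known to belong to \<open>cover_groups\<close>, as for conjugates and
  for the semidirect product.\<close>

lemma Ker_mu_eq:
  assumes "\<And>g. g \<in> F \<Longrightarrow> \<exists>u. covers g u"
  shows "Ker_mu \<Delta> W F = {g \<in> F. fibrewise g}"
proof -
  have "mu \<Delta> W g = (\<lambda>w\<in>W. w) \<longleftrightarrow> fibrewise g" if "g \<in> F" for g
    using assms[OF that] covers_mu by metis
  then show ?thesis by (auto simp: Ker_mu_def kernel_def)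
qed

end

subsection \<open>Covering groups and their kernels\<close>

locale cover_theory = regular_cover G act \<Delta> W
  for G :: "('g, 'b) monoid_scheme" (structure) and act :: "'g \<Rightarrow> 'd \<Rightarrow> 'd"
    and \<Delta> :: "'d set" and W :: "'w set" +
  fixes \<Upsilon> :: "('w \<Rightarrow> 'w) set"
  assumes closed_\<Upsilon>: "closed_subgroup_Sym \<Upsilon> W"
begin

abbreviation "covering_groups \<equiv> cover_groups G act \<Delta> W \<Upsilon>"
abbreviation "cker \<equiv> cover_kernel G act \<Delta> W"
abbreviation "power_act \<equiv> fibrewise_act act \<Delta> W"
abbreviation "ckers \<equiv> cover_kernels G act \<Delta> W \<Upsilon>"
abbreviation "crel \<equiv> kernel_rel G act \<Delta> W \<Upsilon>"
abbreviation "conjugate \<equiv> conj_Bij (\<Delta> \<times> W)"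

lemma subgroup_\<Upsilon>: "subgroup \<Upsilon> (BijGroup W)"
  using closed_\<Upsilon> by (simp add: closed_subgroup_Sym_def)

lemma \<Upsilon>_Bij: "u \<in> \<Upsilon> \<Longrightarrow> u \<in> Bij W"
  using subgroup.subset[OF subgroup_\<Upsilon>] by auto

lemma cover_groupsD:
  assumes "F \<in> covering_groups"
  shows "closed_subgroup_Sym F (\<Delta> \<times> W)" "subgroup F (BijGroup (\<Delta> \<times> W))"
    and "F \<subseteq> Bij (\<Delta> \<times> W)"
    and "mu \<Delta> W ` F = \<Upsilon>"
    and "w \<in> W \<Longrightarrow> induced_on_fibre \<Delta> W F w = act ` carrier G"
    and "w \<in> W \<Longrightarrow> induced_on_fibre \<Delta> W (Ker_mu \<Delta> W F) w = act ` carrier G"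
  using assms subgroup.subset[of F "BijGroup (\<Delta> \<times> W)"]
  by (simp_all add: cover_groups_def closed_subgroup_Sym_def)

text \<open>Each fibre is sent onto a whole fibre, so the projection of its image is a singleton and
  \<open>mu\<close> names the right base point.\<close>

lemma cover_group_covers:
  assumes F: "F \<in> covering_groups" and g: "g \<in> F"
  shows "covers g (mu \<Delta> W g)"
  unfolding covers_def
proof (intro conjI ballI)
  show "g \<in> Bij (\<Delta> \<times> W)" using cover_groupsD(3)[OF F] g by blast
  show "mu \<Delta> W g \<in> Bij W" using cover_groupsD(4)[OF F] g \<Upsilon>_Bij by blast
  fix \<delta> w assume \<delta>: "\<delta> \<in> \<Delta>" and w: "w \<in> W"
  obtain v where v: "v \<in> W" "g ` fibre \<Delta> W w = fibre \<Delta> W v"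
    using F g w unfolding cover_groups_def preserves_fibres_def by blast
  have "snd ` fibre \<Delta> W v = {v}"
    using v(1) \<delta> by (auto simp: fibre_eq)
  then have "mu \<Delta> W g w = v"
    using v w by (simp add: mu_def)
  moreover have "g (\<delta>, w) \<in> g ` fibre \<Delta> W w"
    using \<delta> w by (intro imageI) (simp add: fibre_eq)
  then have "g (\<delta>, w) \<in> fibre \<Delta> W v" using v by simp
  ultimately show "snd (g (\<delta>, w)) = mu \<Delta> W g w"
    by (simp add: fibre_def)
qed

lemma cover_groupsI:
  assumes closed: "closed_subgroup_Sym F (\<Delta> \<times> W)"
    and cov: "\<And>g. g \<in> F \<Longrightarrow> \<exists>u\<in>\<Upsilon>. covers g u" and lift: "\<And>u. u \<in> \<Upsilon> \<Longrightarrow> \<exists>g\<in>F. covers g u"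
    and "\<And>w. w \<in> W \<Longrightarrow> induced_on_fibre \<Delta> W F w = act ` carrier G"
    and "\<And>w. w \<in> W \<Longrightarrow> induced_on_fibre \<Delta> W (Ker_mu \<Delta> W F) w = act ` carrier G"
  shows "F \<in> covering_groups"
proof -
  have "g ` fibre \<Delta> W w \<in> fibre \<Delta> W ` W" if "g \<in> F" "w \<in> W" for g w
    using cov[OF that(1)] covers_image[OF _ that(2)] Bij_mem[OF \<Upsilon>_Bij that(2)] by blast
  then have "preserves_fibres \<Delta> W F"
    by (simp add: preserves_fibres_def)
  moreover have "mu \<Delta> W ` F = \<Upsilon>"
  proof
    show "mu \<Delta> W ` F \<subseteq> \<Upsilon>" using cov covers_mu by blast
    show "\<Upsilon> \<subseteq> mu \<Delta> W ` F" using lift covers_mu by blast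
  qed
  ultimately show ?thesis
    using assms by (simp add: cover_groups_def)
qed

lemma Ker_mu_cover_group:
  "F \<in> covering_groups \<Longrightarrow> Ker_mu \<Delta> W F = {g \<in> F. fibrewise g}"
  by (intro Ker_mu_eq exI) (rule cover_group_covers)

lemma cover_kernel_iff:
  assumes "F \<in> covering_groups"
  shows "f \<in> cker F \<longleftrightarrow> f \<in> carrier (power_group G W) \<and> fibrewise_act act \<Delta> W f \<in> F"
  unfolding cover_kernel_def Ker_mu_cover_group[OF assms] using fibrewise_act_fibrewise by blast

text \<open>A kernel element stabilizes every fibre, so its restriction to each fibre lies in the
  induced group, which is \<open>G\<close>. Choosing a group element for each fibre gives a point of
  \<open>G^W\<close>; thus kernels are subgroups of the power.\<close>

lemma Ker_mu_eq_fibrewise_act: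
  assumes F: "F \<in> covering_groups"
  shows "Ker_mu \<Delta> W F = fibrewise_act act \<Delta> W ` cker F"
proof
  show "fibrewise_act act \<Delta> W ` cker F \<subseteq> Ker_mu \<Delta> W F"
    by (auto simp: cover_kernel_def)
  show "Ker_mu \<Delta> W F \<subseteq> fibrewise_act act \<Delta> W ` cker F"
  proof
    fix g assume gK: "g \<in> Ker_mu \<Delta> W F"
    then have g: "g \<in> F" "fibrewise g"
      using Ker_mu_cover_group[OF F] by auto
    have stab: "g ` fibre \<Delta> W w = fibre \<Delta> W w" if "w \<in> W" for w
      using g(2) that by (simp add: fibrewise_iff)
    have "\<forall>w\<in>W. \<exists>a. a \<in> carrier G \<and> part g w = act a"
    proof
      fix w assume w: "w \<in> W"
      have "part g w \<in> induced_on_fibre \<Delta> W F w"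
        unfolding induced_on_fibre_part using g stab[OF w] by blast
      then show "\<exists>a. a \<in> carrier G \<and> part g w = act a"
        using cover_groupsD(5)[OF F w] by auto
    qed
    then obtain a where a: "\<And>w. w \<in> W \<Longrightarrow> a w \<in> carrier G \<and> part g w = act (a w)"
      by metis
    define f where "f = (\<lambda>w\<in>W. a w)"
    have f: "f \<in> carrier (power_group G W)"
      using a by (simp add: f_def)
    have "fibrewise_act act \<Delta> W f = g"
    proof (rule Bij_eqI)
      show "fibrewise_act act \<Delta> W f \<in> Bij (\<Delta> \<times> W)" "g \<in> Bij (\<Delta> \<times> W)"
        using fibrewise_act_fibrewise[OF f] g(2) coversD(1) by auto
      fix x assume "x \<in> \<Delta> \<times> W"
      then obtain \<delta> w where x: "x = (\<delta>, w)" "\<delta> \<in> \<Delta>" "w \<in> W" by blast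
      then show "fibrewise_act act \<Delta> W f x = g x"
        using part_apply[OF stab[OF x(3)] x(3) x(2)] a by (simp add: fibrewise_act_apply f_def)
    qed
    then show "g \<in> fibrewise_act act \<Delta> W ` cker F"
      using f g cover_kernel_iff[OF F] by (metis image_eqI)
  qed
qed

lemma subgroup_cover_kernel:
  assumes F: "F \<in> covering_groups"
  shows "subgroup (cker F) (power_group G W)"
proof -
  interpret P: group "power_group G W" by (rule product_group) (rule group_axioms)
  interpret hom: group_hom "power_group G W" "BijGroup (\<Delta> \<times> W)" "fibrewise_act act \<Delta> W"
    by (rule fibrewise_act_hom)
  note sub = cover_groupsD(2)[OF F]
  show ?thesis
  proof (rule P.subgroupI)
    show "cker F \<subseteq> carrier (power_group G W)" by (auto simp: cover_kernel_def)
    have "\<one>\<^bsub>power_group G W\<^esub> \<in> cker F"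
      unfolding cover_kernel_iff[OF F] using hom.hom_one subgroup.one_closed[OF sub] P.one_closed by metis
    then show "cker F \<noteq> {}" by blast
  next
    fix f assume "f \<in> cker F"
    then show "inv\<^bsub>power_group G W\<^esub> f \<in> cker F"
      unfolding cover_kernel_iff[OF F] using hom.hom_inv subgroup.m_inv_closed[OF sub] P.inv_closed by metis
  next
    fix f h assume "f \<in> cker F" "h \<in> cker F"
    then show "f \<otimes>\<^bsub>power_group G W\<^esub> h \<in> cker F"
      unfolding cover_kernel_iff[OF F] using hom.hom_mult subgroup.m_closed[OF sub] P.m_closed by metis
  qed
qed

text \<open>Surjectivity at \<open>w\<close> is the requirement that the kernel alone induces all of
  \<open>G\<close> on the fibre. Regularity, tested at one point, recovers the group element from
  its permutation.\<close>

lemma subdirect_cover_kernel: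
  assumes F: "F \<in> covering_groups"
  shows "subdirect_power G W (cker F)"
proof (intro subdirect_power.intro)
  show "group G" by (rule group_axioms)
  show "subgroup (cker F) (power_group G W)" by (rule subgroup_cover_kernel[OF F])
  fix w a assume w: "w \<in> W" and a: "a \<in> carrier G"
  then have "act a \<in> induced_on_fibre \<Delta> W (Ker_mu \<Delta> W F) w"
    using cover_groupsD(6)[OF F w] by blast
  then obtain f where f: "f \<in> cker F" "act a = part (fibrewise_act act \<Delta> W f) w"
    unfolding induced_on_fibre_part Ker_mu_eq_fibrewise_act[OF F] by blast
  then have fw: "f w \<in> carrier G"
    using w cover_kernel_iff[OF F] by auto
  obtain \<delta> where "\<delta> \<in> \<Delta>" by (rule ex_point)
  then have "act a \<delta> = act (f w) \<delta>"
    using f(2) w by (simp add: part_def fibrewise_act_apply)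
  then have "f w = a"
    using act_eq_iff[OF a fw \<open>\<delta> \<in> \<Delta>\<close>] by simp
  then show "\<exists>k\<in>cker F. k w = a"
    using f(1) by blast
qed

text \<open>Closedness of \<open>F\<close> passes to its kernel: a finite subset of
  \<open>\<Delta> \<times> W\<close> meets finitely many fibres, so approximation in
  \<open>G^W\<close> gives approximation in \<open>Sym(\<Delta> \<times> W)\<close>.\<close>

lemma cover_kernel_closed:
  assumes F: "F \<in> covering_groups" and f: "f \<in> carrier (power_group G W)"
    and approx: "\<And>T. finite T \<Longrightarrow> T \<subseteq> W \<Longrightarrow> \<exists>k\<in>cker F. \<forall>t\<in>T. k t = f t"
  shows "f \<in> cker F"
proof -
  have "fibrewise_act act \<Delta> W f \<in> F"
  proof (rule closedin_Sym_topologyD)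
    show "closedin (Sym_topology (\<Delta> \<times> W)) F"
      using cover_groupsD(1)[OF F] by (simp add: closed_subgroup_Sym_def)
    show "fibrewise_act act \<Delta> W f \<in> Bij (\<Delta> \<times> W)"
      by (rule coversD(1)[OF fibrewise_act_fibrewise[OF f]])
    fix T assume T: "finite T" "T \<subseteq> \<Delta> \<times> W"
    then have "finite (snd ` T)" "snd ` T \<subseteq> W" by auto
    then obtain k where k: "k \<in> cker F" "\<forall>t\<in>T. k (snd t) = f (snd t)"
      using approx by (metis image_eqI)
    have "fibrewise_act act \<Delta> W k t = fibrewise_act act \<Delta> W f t" if "t \<in> T" for t
    proof -
      have "t = (fst t, snd t)" "fst t \<in> \<Delta>" "snd t \<in> W" "k (snd t) = f (snd t)"
        using that T k(2) by auto
      then show ?thesis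
        using fibrewise_act_apply by metis
    qed
    then show "\<exists>h\<in>F. \<forall>t\<in>T. h t = fibrewise_act act \<Delta> W f t"
      using k(1) cover_kernel_iff[OF F] by blast
  qed
  then show ?thesis
    using f cover_kernel_iff[OF F] by blast
qed

text \<open>In a regular action an element fixing one point is trivial, and \<open>g\<close> carries
  fixed points of a permutation to fixed points of its conjugate. Used for isomorphisms in
  \<open>rho_of_kernel_rel\<close> and for elements of \<open>F\<close> in
  \<open>rho_of_congruence\<close>.\<close>

lemma conj_trivial_at_iff:
  assumes g: "covers g u" and k: "k \<in> carrier (power_group G W)" and l: "l \<in> carrier (power_group G W)"
    and eq: "conjugate g (fibrewise_act act \<Delta> W k) = fibrewise_act act \<Delta> W l" and w: "w \<in> W"
  shows "l (u w) = \<one> \<longleftrightarrow> k w = \<one>"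
proof -
  obtain \<delta> where \<delta>: "\<delta> \<in> \<Delta>" by (rule ex_point)
  have kw: "k w \<in> carrier G" and lw: "l (u w) \<in> carrier G"
    using k l w Bij_mem[OF coversD(2)[OF g] w] by auto
  define \<epsilon> where "\<epsilon> = fst (g (\<delta>, w))"
  have g\<delta>: "g (\<delta>, w) = (\<epsilon>, u w)" "\<epsilon> \<in> \<Delta>" "u w \<in> W"
    using covers_apply[OF g \<delta> w] by (auto simp: \<epsilon>_def)
  have "fibrewise_act act \<Delta> W l (g (\<delta>, w)) = g (fibrewise_act act \<Delta> W k (\<delta>, w))"
    unfolding eq[symmetric]
    using conj_Bij_apply[OF coversD(1)[OF g] coversD(1)[OF fibrewise_act_fibrewise[OF k]]] \<delta> w by simp
  then have "(act (l (u w)) \<epsilon>, u w) = g (act (k w) \<delta>, w)"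
    using g\<delta> \<delta> w by (simp add: fibrewise_act_apply)
  then have "act (l (u w)) \<epsilon> = \<epsilon> \<longleftrightarrow> g (act (k w) \<delta>, w) = g (\<delta>, w)"
    using g\<delta>(1) by (metis prod.inject)
  also have "\<dots> \<longleftrightarrow> act (k w) \<delta> = \<delta>"
    using Bij_inj[OF coversD(1)[OF g], of "(act (k w) \<delta>, w)" "(\<delta>, w)"] \<delta> w act_mem[OF kw \<delta>] by simp
  finally show ?thesis
    using act_fixed_iff[OF kw \<delta>] act_fixed_iff[OF lw g\<delta>(2)] by simp
qed

section \<open>Conjugating covering groups by fibrewise permutations\<close>

definition normalizes :: "('d \<times> 'w \<Rightarrow> 'd \<times> 'w) \<Rightarrow> bool" where
  "normalizes p \<longleftrightarrow> (\<forall>w\<in>W. conj_Bij \<Delta> (part p w) ` act ` carrier G = act ` carrier G)"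

lemma fibrewise_conj_iff:
  assumes p: "fibrewise p" and g: "g \<in> Bij (\<Delta> \<times> W)"
  shows "fibrewise (conjugate p g) \<longleftrightarrow> fibrewise g"
proof
  assume "fibrewise (conjugate p g)"
  then show "fibrewise g"
    using fibrewise_conj[OF covers_inv[OF p]] conj_Bij_inv(1)[OF coversD(1)[OF p] g] by metis
qed (rule fibrewise_conj[OF p])

lemma Ker_mu_conj:
  assumes F: "F \<in> covering_groups" and p: "fibrewise p"
  shows "Ker_mu \<Delta> W (conjugate p ` F) = conjugate p ` Ker_mu \<Delta> W F"
proof -
  have "Ker_mu \<Delta> W (conjugate p ` F) = {g \<in> conjugate p ` F. fibrewise g}"
    by (rule Ker_mu_eq) (use covers_conj_fibrewise[OF p cover_group_covers[OF F]] in blast)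
  also have "\<dots> = conjugate p ` {g \<in> F. fibrewise g}"
    using fibrewise_conj_iff[OF p] cover_groupsD(3)[OF F] by blast
  finally show ?thesis
    using Ker_mu_cover_group[OF F] by simp
qed

text \<open>Normalizing \<open>G\<close> on every fibre keeps both induced groups equal to
  \<open>G\<close>. The other conditions survive every fibrewise conjugation, since base
  permutations do not change.\<close>

lemma conj_cover_group:
  assumes F: "F \<in> covering_groups" and p: "fibrewise p" and norm: "normalizes p"
  shows "conjugate p ` F \<in> covering_groups"
proof (rule cover_groupsI)
  show "closed_subgroup_Sym (conjugate p ` F) (\<Delta> \<times> W)"
    by (rule conj_Bij_closed_subgroup[OF coversD(1)[OF p] cover_groupsD(1)[OF F]])
next
  fix g assume "g \<in> conjugate p ` F"
  then obtain h where h: "h \<in> F" "g = conjugate p h" by blast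
  then have "covers g (mu \<Delta> W h)" "mu \<Delta> W h \<in> \<Upsilon>"
    using covers_conj_fibrewise[OF p cover_group_covers[OF F h(1)]] cover_groupsD(4)[OF F] by auto
  then show "\<exists>u\<in>\<Upsilon>. covers g u" by blast
next
  fix u assume "u \<in> \<Upsilon>"
  then obtain h where h: "h \<in> F" "mu \<Delta> W h = u"
    using cover_groupsD(4)[OF F] by blast
  then have "covers (conjugate p h) u"
    using covers_conj_fibrewise[OF p cover_group_covers[OF F h(1)]] by simp
  then show "\<exists>g\<in>conjugate p ` F. covers g u" using h(1) by blast
next
  fix w assume w: "w \<in> W"
  show "induced_on_fibre \<Delta> W (conjugate p ` F) w = act ` carrier G"
    using induced_on_fibre_conj[OF p cover_groupsD(3)[OF F] w] cover_groupsD(5)[OF F w] norm w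
    by (simp add: normalizes_def)
  have "Ker_mu \<Delta> W F \<subseteq> Bij (\<Delta> \<times> W)"
    using Ker_mu_cover_group[OF F] cover_groupsD(3)[OF F] by blast
  from induced_on_fibre_conj[OF p this w]
  show "induced_on_fibre \<Delta> W (Ker_mu \<Delta> W (conjugate p ` F)) w = act ` carrier G"
    using cover_groupsD(6)[OF F w] norm w Ker_mu_conj[OF F p] by (simp add: normalizes_def)
qed

text \<open>The conclusion mentions \<open>p\<close> only, so an isomorphism of one pair of covering
  groups can be applied to any other covering group.\<close>

lemma normalizes_if_conj:
  assumes F: "F \<in> covering_groups" and p: "fibrewise p" and F': "conjugate p ` F \<in> covering_groups"
  shows "normalizes p"
  unfolding normalizes_def
  using induced_on_fibre_conj[OF p cover_groupsD(3)[OF F]] cover_groupsD(5)[OF F] cover_groupsD(5)[OF F']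
  by simp

section \<open>The relation on kernels is an equivalence relation\<close>

lemma cover_isomorphic_iff:
  "cover_isomorphic \<Delta> W F1 F2 \<longleftrightarrow> (\<exists>p. fibrewise p \<and> conjugate p ` F1 = F2)"
  unfolding cover_isomorphic_def fibrewise_iff conj_Bij_def[abs_def] by blast

lemma kernel_relE:
  assumes "(K1, K2) \<in> crel"
  obtains F p where "F \<in> covering_groups" "fibrewise p" "conjugate p ` F \<in> covering_groups"
    "K1 = cker F" "K2 = cker (conjugate p ` F)"
  using assms unfolding kernel_rel_def cover_isomorphic_iff by blast

lemma kernel_relI:
  assumes "F \<in> covering_groups" "fibrewise p" "conjugate p ` F \<in> covering_groups"
  shows "(cker F, cker (conjugate p ` F)) \<in> crel"
  using assms unfolding kernel_rel_def cover_isomorphic_iff by blast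

lemma fibrewise_id: "fibrewise (\<lambda>x\<in>\<Delta> \<times> W. x)"
  by (simp add: covers_def id_Bij)

lemma fibrewise_mult:
  "fibrewise p \<Longrightarrow> fibrewise q \<Longrightarrow> fibrewise (p \<otimes>\<^bsub>BijGroup (\<Delta> \<times> W)\<^esub> q)"
  using covers_mult[of p "\<lambda>w\<in>W. w" q "\<lambda>w\<in>W. w"]
  by (simp add: BijGroup_def id_Bij Id_compose)

lemma fibrewise_inv: "fibrewise p \<Longrightarrow> fibrewise (inv\<^bsub>BijGroup (\<Delta> \<times> W)\<^esub> p)"
  using covers_inv[of p "\<lambda>w\<in>W. w"] monoid.inv_one[OF group.is_monoid[OF group_BijGroup[of W]]]
  by simp

lemma kernel_rel_sym:
  assumes "(K1, K2) \<in> crel"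
  shows "(K2, K1) \<in> crel"
  using assms
proof (rule kernel_relE)
  fix F p
  assume F: "F \<in> covering_groups" and p: "fibrewise p" and F': "conjugate p ` F \<in> covering_groups"
    and K: "K1 = cker F" "K2 = cker (conjugate p ` F)"
  have "conjugate (inv\<^bsub>BijGroup (\<Delta> \<times> W)\<^esub> p) ` conjugate p ` F = F"
    by (rule conj_image_inv[OF coversD(1)[OF p] cover_groupsD(3)[OF F]])
  then show "(K2, K1) \<in> crel"
    using kernel_relI[OF F' fibrewise_inv[OF p]] F K by simp
qed

text \<open>The two groups with kernel \<open>K2\<close> may differ, but the isomorphism \<open>q\<close> of the second one can
  also be applied to the first.\<close>

lemma kernel_rel_trans:
  assumes "(K1, K2) \<in> crel" "(K2, K3) \<in> crel"
  shows "(K1, K3) \<in> crel"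
proof -
  obtain F p where F: "F \<in> covering_groups" and p: "fibrewise p"
    and pF: "conjugate p ` F \<in> covering_groups" and K: "K1 = cker F" "K2 = cker (conjugate p ` F)"
    using assms(1) by (rule kernel_relE)
  obtain E q where E: "E \<in> covering_groups" and q: "fibrewise q"
    and qE: "conjugate q ` E \<in> covering_groups" and K': "K2 = cker E" "K3 = cker (conjugate q ` E)"
    using assms(2) by (rule kernel_relE)
  let ?F = "conjugate q ` conjugate p ` F"
  have qpF: "?F \<in> covering_groups"
    by (rule conj_cover_group[OF pF q normalizes_if_conj[OF E q qE]])
  \<comment> \<open>Both groups with kernel \<open>K2\<close> have the same \<open>Ker_mu\<close>,
    namely the image of \<open>K2\<close> under \<open>fibrewise_act\<close>; conjugation by
    \<open>q\<close> preserves this equality.\<close>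
  have "Ker_mu \<Delta> W ?F = Ker_mu \<Delta> W (conjugate q ` E)"
    using Ker_mu_conj[OF pF q] Ker_mu_conj[OF E q] K(2) K'(1)
      Ker_mu_eq_fibrewise_act[OF pF] Ker_mu_eq_fibrewise_act[OF E] by simp
  then have "cker ?F = K3"
    using K'(2) by (simp add: cover_kernel_def)
  moreover have "?F = conjugate (q \<otimes>\<^bsub>BijGroup (\<Delta> \<times> W)\<^esub> p) ` F"
    by (rule conj_image_mult[OF coversD(1)[OF q] coversD(1)[OF p] cover_groupsD(3)[OF F]])
  ultimately show ?thesis
    using kernel_relI[OF F fibrewise_mult[OF q p]] qpF K(1) by simp
qed

lemma kernel_rel_refl:
  assumes "F \<in> covering_groups"
  shows "(cker F, cker F) \<in> crel"
proof -
  have "cover_isomorphic \<Delta> W F F"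
    unfolding cover_isomorphic_iff
  proof (intro exI conjI)
    show "fibrewise (\<lambda>x\<in>\<Delta> \<times> W. x)" by (rule fibrewise_id)
    have "conjugate (\<lambda>x\<in>\<Delta> \<times> W. x) g = g" if "g \<in> F" for g
      using cover_groupsD(3)[OF assms] that
      by (intro conj_Bij_eqI) (auto simp: id_Bij dest: Bij_mem)
    then show "conjugate (\<lambda>x\<in>\<Delta> \<times> W. x) ` F = F" by simp
  qed
  then show ?thesis
    using assms unfolding kernel_rel_def by blast
qed

lemma equiv_kernel_rel: "equiv ckers crel"
proof (rule equivI)
  show "crel \<subseteq> ckers \<times> ckers"
    by (auto simp: kernel_rel_def cover_kernels_def)
  show "refl_on ckers crel"
    by (rule refl_onI) (auto simp: cover_kernels_def kernel_rel_refl)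
  show "sym crel" by (blast intro: symI kernel_rel_sym)
  show "trans crel" by (blast intro: transI kernel_rel_trans)
qed

section \<open>The congruence attached to a kernel\<close>

lemma cover_kernel_carrier: "f \<in> cker F \<Longrightarrow> f \<in> carrier (power_group G W)"
  by (simp add: cover_kernel_def)

lemma rho_of_cover_kernel:
  assumes "finite (carrier G)" "F \<in> covering_groups"
  shows "(x, y) \<in> rho_of G W (cker F) \<longleftrightarrow>
    x \<in> W \<and> y \<in> W \<and> (\<forall>k\<in>cker F. k x = \<one> \<longrightarrow> k y = \<one>)"
  using subdirect_power.rho_of_iff[OF subdirect_cover_kernel[OF assms(2)] assms(1)]
    subdirect_power.determines_def[OF subdirect_cover_kernel[OF assms(2)]] by simp

text \<open>An isomorphism pairs the elements of the two kernels so that partners are trivial at the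
  same points, and \<open>rho_of\<close> depends only on these sets of points. One inclusion is
  proved for all related pairs; symmetry of the relation gives the other.\<close>

lemma rho_of_kernel_rel:
  assumes fin: "finite (carrier G)" and rel: "(K1, K2) \<in> crel"
  shows "rho_of G W K1 = rho_of G W K2"
proof -
  have "rho_of G W K \<subseteq> rho_of G W L" if "(K, L) \<in> crel" for K L
    using that
  proof (rule kernel_relE)
    fix F p
    assume F: "F \<in> covering_groups" and p: "fibrewise p" and F': "conjugate p ` F \<in> covering_groups"
      and K: "K = cker F" and L: "L = cker (conjugate p ` F)"
    have *: "\<exists>k\<in>K. \<forall>w\<in>W. l w = \<one> \<longleftrightarrow> k w = \<one>" if l: "l \<in> L" for l
    proof -
      have "power_act l \<in> Ker_mu \<Delta> W (conjugate p ` F)"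
        using l L by (simp add: cover_kernel_def)
      then obtain k where k: "k \<in> K" "conjugate p (power_act k) = power_act l"
        unfolding Ker_mu_conj[OF F p] Ker_mu_eq_fibrewise_act[OF F] K by auto
      have kl: "k \<in> carrier (power_group G W)" "l \<in> carrier (power_group G W)"
        using k l K L cover_kernel_carrier by auto
      show ?thesis
        using conj_trivial_at_iff[OF p kl k(2)] k(1) by auto
    qed
    show "rho_of G W K \<subseteq> rho_of G W L"
    proof (rule subrelI)
      fix x y assume "(x, y) \<in> rho_of G W K"
      then have xy: "x \<in> W" "y \<in> W" "\<forall>k\<in>K. k x = \<one> \<longrightarrow> k y = \<one>"
        using rho_of_cover_kernel[OF fin F] K by auto
      then have "\<forall>l\<in>L. l x = \<one> \<longrightarrow> l y = \<one>"
        using * by metis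
      then show "(x, y) \<in> rho_of G W L"
        using rho_of_cover_kernel[OF fin F'] L xy by auto
    qed
  qed
  then show ?thesis
    using rel kernel_rel_sym by blast
qed

text \<open>A lift \<open>g\<close> of \<open>u\<close> to \<open>F\<close> normalizes the kernel.
  An element \<open>l\<close> trivial at \<open>u x\<close> is pulled back along \<open>g\<close> to
  one trivial at \<open>x\<close>, hence at \<open>y\<close>; pushing it forward again shows that
  \<open>l\<close> is trivial at \<open>u y\<close>.\<close>

lemma rho_of_congruence:
  assumes fin: "finite (carrier G)" and F: "F \<in> covering_groups"
  shows "rho_of G W (cker F) \<in> congruences W \<Upsilon>"
proof -
  have "(u x, u y) \<in> rho_of G W (cker F)"
    if u: "u \<in> \<Upsilon>" and xy: "(x, y) \<in> rho_of G W (cker F)" for u x y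
  proof -
    have xyW: "x \<in> W" "y \<in> W" and det: "\<And>k. k \<in> cker F \<Longrightarrow> k x = \<one> \<Longrightarrow> k y = \<one>"
      using xy rho_of_cover_kernel[OF fin F] by auto
    obtain g where g: "g \<in> F" "mu \<Delta> W g = u"
      using u cover_groupsD(4)[OF F] by blast
    have cov: "covers g u" using cover_group_covers[OF F g(1)] g(2) by simp
    let ?i = "inv\<^bsub>BijGroup (\<Delta> \<times> W)\<^esub> g"
    have "l (u y) = \<one>" if l: "l \<in> cker F" "l (u x) = \<one>" for l
    proof -
      have lc: "l \<in> carrier (power_group G W)" "power_act l \<in> F"
        using l(1) cover_kernel_iff[OF F] by auto
      have lB: "power_act l \<in> Bij (\<Delta> \<times> W)"
        using coversD(1)[OF fibrewise_act_fibrewise[OF lc(1)]] .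
      have "?i \<in> F"
        using subgroup.m_inv_closed[OF cover_groupsD(2)[OF F] g(1)] .
      then have "conjugate ?i (power_act l) \<in> F"
        using subgroup.m_closed[OF cover_groupsD(2)[OF F]]
          subgroup.m_inv_closed[OF cover_groupsD(2)[OF F]] lc(2)
        unfolding conj_Bij_def by blast
      moreover have "fibrewise (conjugate ?i (power_act l))"
        by (rule fibrewise_conj[OF covers_inv[OF cov] fibrewise_act_fibrewise[OF lc(1)]])
      ultimately have "conjugate ?i (power_act l) \<in> Ker_mu \<Delta> W F"
        using Ker_mu_cover_group[OF F] by simp
      then obtain k where k: "k \<in> cker F" "conjugate ?i (power_act l) = power_act k"
        unfolding Ker_mu_eq_fibrewise_act[OF F] by blast
      then have eq: "conjugate g (power_act k) = power_act l"
        using conj_Bij_inv(2)[OF coversD(1)[OF cov] lB] by simp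
      note iff = conj_trivial_at_iff[OF cov cover_kernel_carrier[OF k(1)] lc(1) eq]
      show ?thesis
        using iff[OF xyW(1)] iff[OF xyW(2)] det[OF k(1)] l(2) by simp
    qed
    then show ?thesis
      using rho_of_cover_kernel[OF fin F] xyW Bij_mem[OF \<Upsilon>_Bij[OF u]] by simp
  qed
  then show ?thesis
    using subdirect_power.equiv_rho_of[OF subdirect_cover_kernel[OF F] fin]
    by (auto simp: congruences_def)
qed

end

subsection \<open>The semidirect product realizing a congruence\<close>

lemma K_of_iff:
  assumes "equiv W \<rho>"
  shows "f \<in> K_of G W \<rho> \<longleftrightarrow> f \<in> carrier (power_group G W) \<and> (\<forall>(x, y)\<in>\<rho>. f x = f y)"
proof -
  have "(\<forall>C\<in>W // \<rho>. f constant_on C) \<longleftrightarrow> (\<forall>(x, y)\<in>\<rho>. f x = f y)"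
  proof (intro iffI ballI)
    fix z assume *: "\<forall>C\<in>W // \<rho>. f constant_on C" and "z \<in> \<rho>"
    then obtain x y where z: "z = (x, y)" "(x, y) \<in> \<rho>" by (metis surj_pair)
    then have xW: "x \<in> W" using equiv_type[OF assms] by blast
    then have "f constant_on (\<rho> `` {x})" using * by (simp add: quotientI)
    moreover have "x \<in> \<rho> `` {x}" "y \<in> \<rho> `` {x}"
      using z equiv_class_self[OF assms xW] by auto
    ultimately show "case z of (x, y) \<Rightarrow> f x = f y"
      using z(1) by (auto simp: constant_on_def)
  next
    fix C assume *: "\<forall>(x, y)\<in>\<rho>. f x = f y" and "C \<in> W // \<rho>"
    then obtain x where "C = \<rho> `` {x}" by (auto elim: quotientE)
    then show "f constant_on C"
      using * unfolding constant_on_def by (intro exI[of _ "f x"]) auto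
  qed
  then show ?thesis by (simp add: K_of_def)
qed

context cover_theory
begin

lemma power_act_inj:
  assumes "f \<in> carrier (power_group G W)" "h \<in> carrier (power_group G W)" "power_act f = power_act h"
  shows "f = h"
proof (rule extensionalityI[where A = W])
  show "f \<in> extensional W" "h \<in> extensional W" using assms by (auto simp: PiE_def)
  fix w assume w: "w \<in> W"
  obtain \<delta> where \<delta>: "\<delta> \<in> \<Delta>" by (rule ex_point)
  have "act (f w) \<delta> = act (h w) \<delta>"
    using fibrewise_act_apply[OF \<delta> w] assms(3) by (metis prod.inject)
  moreover have "f w \<in> carrier G" "h w \<in> carrier G" using assms w by auto
  ultimately show "f w = h w" using act_eq_iff \<delta> by blast
qed

text \<open>Since \<open>power_act\<close> is injective, kernels in \<open>G^W\<close> may be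
  compared as permutation groups.\<close>

lemma cover_kernel_eqI:
  assumes F: "F \<in> covering_groups" and X: "X \<subseteq> carrier (power_group G W)"
    and Ker: "Ker_mu \<Delta> W F = power_act ` X"
  shows "cker F = X"
  using Ker X power_act_inj unfolding cover_kernel_def by blast

text \<open>The wreath product rule: when \<open>f\<close> acts, the fibre over \<open>w\<close> has
  already been moved to the fibre over \<open>v w\<close>.\<close>

lemma skew_mult:
  assumes f: "\<And>w. w \<in> W \<Longrightarrow> f w \<in> carrier G" and u: "u \<in> Bij W"
    and h: "\<And>w. w \<in> W \<Longrightarrow> h w \<in> carrier G" and v: "v \<in> Bij W"
  shows "skew f u \<otimes>\<^bsub>BijGroup (\<Delta> \<times> W)\<^esub> skew h v =
    skew (\<lambda>w\<in>W. f (v w) \<otimes> h w) (u \<otimes>\<^bsub>BijGroup W\<^esub> v)"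
proof (rule Bij_eqI)
  have B: "skew f u \<in> Bij (\<Delta> \<times> W)" "skew h v \<in> Bij (\<Delta> \<times> W)"
    using coversD(1)[OF skew_covers[of f, OF f u]] coversD(1)[OF skew_covers[of h, OF h v]] by auto
  then show "skew f u \<otimes>\<^bsub>BijGroup (\<Delta> \<times> W)\<^esub> skew h v \<in> Bij (\<Delta> \<times> W)"
    by (rule BijGroup_closed)
  show "skew (\<lambda>w\<in>W. f (v w) \<otimes> h w) (u \<otimes>\<^bsub>BijGroup W\<^esub> v) \<in> Bij (\<Delta> \<times> W)"
    by (rule coversD(1)[OF skew_covers]) (use f h u v Bij_mem[OF v] in \<open>auto simp: BijGroup_closed\<close>)
  fix x assume "x \<in> \<Delta> \<times> W"
  then obtain \<delta> w where x: "x = (\<delta>, w)" "\<delta> \<in> \<Delta>" "w \<in> W" by blast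
  then show "(skew f u \<otimes>\<^bsub>BijGroup (\<Delta> \<times> W)\<^esub> skew h v) x =
      skew (\<lambda>w\<in>W. f (v w) \<otimes> h w) (u \<otimes>\<^bsub>BijGroup W\<^esub> v) x"
    using B f h u v Bij_mem[OF v]
    by (simp add: BijGroup_mult_apply skew_apply act_mult act_mem)
qed

text \<open>A copy of the semidirect product of \<open>K_of G W \<rho>\<close> with
  \<open>\<Upsilon>\<close>; the complement consists of the permutations with trivial first
  component, which move fibres rigidly.\<close>

definition semidirect :: "('w \<times> 'w) set \<Rightarrow> ('d \<times> 'w \<Rightarrow> 'd \<times> 'w) set" where
  "semidirect \<rho> = {skew f u | f u. f \<in> K_of G W \<rho> \<and> u \<in> \<Upsilon>}"

lemma K_of_mem: "f \<in> K_of G W \<rho> \<Longrightarrow> w \<in> W \<Longrightarrow> f w \<in> carrier G"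
  by (auto simp: K_of_def)

lemma skew_id: "skew (\<lambda>w\<in>W. \<one>) (\<lambda>w\<in>W. w) = (\<lambda>x\<in>\<Delta> \<times> W. x)"
  by (auto simp: skew_def act_one intro!: restrict_ext)

text \<open>Products and inverses evaluate \<open>f\<close> at a shifted point \<open>v w\<close>;
  invariance of \<open>\<rho>\<close> under \<open>\<Upsilon>\<close> keeps the shifted function
  constant on classes.\<close>

lemma subgroup_semidirect:
  assumes \<rho>: "\<rho> \<in> congruences W \<Upsilon>"
  shows "subgroup (semidirect \<rho>) (BijGroup (\<Delta> \<times> W))"
proof (rule group.subgroupI[OF group_BijGroup])
  have eq: "equiv W \<rho>" and inv\<rho>: "\<And>u x y. u \<in> \<Upsilon> \<Longrightarrow> (x, y) \<in> \<rho> \<Longrightarrow> (u x, u y) \<in> \<rho>"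
    using \<rho> by (auto simp: congruences_def)
  have \<rho>W: "x \<in> W" "y \<in> W" if "(x, y) \<in> \<rho>" for x y
    using that equiv_type[OF eq] by auto
  have cov: "covers (skew f u) u" if "f \<in> K_of G W \<rho>" "u \<in> \<Upsilon>" for f u
    using skew_covers K_of_mem \<Upsilon>_Bij that by blast
  show "semidirect \<rho> \<subseteq> carrier (BijGroup (\<Delta> \<times> W))"
    using coversD(1)[OF cov] by (auto simp: semidirect_def)
  have one: "(\<lambda>w\<in>W. \<one>) \<in> K_of G W \<rho>" "(\<lambda>w\<in>W. w) \<in> \<Upsilon>"
    using subgroup.one_closed[OF subgroup_\<Upsilon>] \<rho>W by (auto simp: K_of_iff[OF eq])
  then show "semidirect \<rho> \<noteq> {}"
    by (auto simp: semidirect_def)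
  show "g \<otimes>\<^bsub>BijGroup (\<Delta> \<times> W)\<^esub> h \<in> semidirect \<rho>"
    if gh: "g \<in> semidirect \<rho>" "h \<in> semidirect \<rho>" for g h
  proof -
    obtain f u where g: "g = skew f u" "f \<in> K_of G W \<rho>" "u \<in> \<Upsilon>"
      using gh by (auto simp: semidirect_def)
    obtain k v where h: "h = skew k v" "k \<in> K_of G W \<rho>" "v \<in> \<Upsilon>"
      using gh by (auto simp: semidirect_def)
    have "g \<otimes>\<^bsub>BijGroup (\<Delta> \<times> W)\<^esub> h = skew (\<lambda>w\<in>W. f (v w) \<otimes> k w) (u \<otimes>\<^bsub>BijGroup W\<^esub> v)"
      unfolding g(1) h(1) using g h by (intro skew_mult) (auto simp: K_of_mem \<Upsilon>_Bij)
    moreover have "u \<otimes>\<^bsub>BijGroup W\<^esub> v \<in> \<Upsilon>"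
      by (rule subgroup.m_closed[OF subgroup_\<Upsilon> g(3) h(3)])
    moreover have "(\<lambda>w\<in>W. f (v w) \<otimes> k w) \<in> K_of G W \<rho>"
      unfolding K_of_iff[OF eq]
    proof (intro conjI ballI)
      show "(\<lambda>w\<in>W. f (v w) \<otimes> k w) \<in> carrier (power_group G W)"
        using K_of_mem[OF g(2)] K_of_mem[OF h(2)] Bij_mem[OF \<Upsilon>_Bij[OF h(3)]] by simp
      fix z assume "z \<in> \<rho>"
      then obtain x y where z: "z = (x, y)" "(x, y) \<in> \<rho>" by (metis surj_pair)
      then have "f (v x) = f (v y)" "k x = k y"
        using g(2) h(2) inv\<rho>[OF h(3) z(2)] unfolding K_of_iff[OF eq] by auto
      then show "case z of (x, y) \<Rightarrow> (\<lambda>w\<in>W. f (v w) \<otimes> k w) x = (\<lambda>w\<in>W. f (v w) \<otimes> k w) y"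
        using z \<rho>W by simp
    qed
    ultimately show ?thesis by (auto simp: semidirect_def)
  qed
  show "inv\<^bsub>BijGroup (\<Delta> \<times> W)\<^esub> g \<in> semidirect \<rho>" if gS: "g \<in> semidirect \<rho>" for g
  proof -
    obtain f u where g: "g = skew f u" "f \<in> K_of G W \<rho>" "u \<in> \<Upsilon>"
      using gS by (auto simp: semidirect_def)
    define v where "v = inv\<^bsub>BijGroup W\<^esub> u"
    \<comment> \<open>The solution of \<open>k (u w) \<otimes> f w = \<one>\<close>, the condition
      that \<open>skew_mult\<close> imposes on a left inverse.\<close>
    define k where "k = (\<lambda>w\<in>W. inv (f (v w)))"
    have v: "v \<in> \<Upsilon>" unfolding v_def by (rule subgroup.m_inv_closed[OF subgroup_\<Upsilon> g(3)])
    have vu: "v (u w) = w" if "w \<in> W" for w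
      using BijGroup_inv_apply(1)[OF \<Upsilon>_Bij[OF g(3)] that] by (simp add: v_def)
    have k: "k \<in> K_of G W \<rho>"
      unfolding K_of_iff[OF eq]
    proof (intro conjI ballI)
      show "k \<in> carrier (power_group G W)"
        using K_of_mem[OF g(2)] Bij_mem[OF \<Upsilon>_Bij[OF v]] by (simp add: k_def)
      fix z assume "z \<in> \<rho>"
      then obtain x y where z: "z = (x, y)" "(x, y) \<in> \<rho>" by (metis surj_pair)
      then have "f (v x) = f (v y)"
        using g(2) inv\<rho>[OF v z(2)] unfolding K_of_iff[OF eq] by auto
      then show "case z of (x, y) \<Rightarrow> k x = k y"
        using z \<rho>W by (simp add: k_def)
    qed
    have "skew k v \<otimes>\<^bsub>BijGroup (\<Delta> \<times> W)\<^esub> g = skew (\<lambda>w\<in>W. k (u w) \<otimes> f w) (v \<otimes>\<^bsub>BijGroup W\<^esub> u)"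
      unfolding g(1) using g k v by (intro skew_mult) (auto simp: K_of_mem \<Upsilon>_Bij)
    also have "(\<lambda>w\<in>W. k (u w) \<otimes> f w) = (\<lambda>w\<in>W. \<one>)"
      using K_of_mem[OF g(2)] Bij_mem[OF \<Upsilon>_Bij[OF g(3)]] vu
      by (intro restrict_ext) (simp add: k_def)
    also have "v \<otimes>\<^bsub>BijGroup W\<^esub> u = (\<lambda>w\<in>W. w)"
      using group.l_inv[OF group_BijGroup, of u W] \<Upsilon>_Bij[OF g(3)] by (simp add: v_def)
    finally have "skew k v \<otimes>\<^bsub>BijGroup (\<Delta> \<times> W)\<^esub> g = \<one>\<^bsub>BijGroup (\<Delta> \<times> W)\<^esub>"
      by (simp only: skew_id BijGroup_one)
    then have "inv\<^bsub>BijGroup (\<Delta> \<times> W)\<^esub> g = skew k v"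
      using coversD(1)[OF cov[OF g(2,3)]] coversD(1)[OF cov[OF k v]] g(1)
      by (intro group.inv_equality[OF group_BijGroup]) auto
    then show ?thesis using k v by (auto simp: semidirect_def)
  qed
qed

text \<open>As \<open>\<Delta>\<close> is finite, approximations can be taken on whole fibres, so a
  limit again has \<open>skew\<close> form. Its components are limits of elements of
  \<open>K_of\<close> and of \<open>\<Upsilon>\<close>: the former stay in \<open>K_of\<close>
  because constancy on classes is tested on two points at a time, the latter because
  \<open>\<Upsilon>\<close> is closed.\<close>

lemma closed_semidirect:
  assumes \<rho>: "\<rho> \<in> congruences W \<Upsilon>"
  shows "closedin (Sym_topology (\<Delta> \<times> W)) (semidirect \<rho>)"
proof (rule closedin_Sym_topologyI)
  have eq: "equiv W \<rho>" using \<rho> by (auto simp: congruences_def)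
  show "semidirect \<rho> \<subseteq> Bij (\<Delta> \<times> W)"
    using subgroup.subset[OF subgroup_semidirect[OF \<rho>]] by simp
  fix g assume g: "g \<in> Bij (\<Delta> \<times> W)"
    and approx: "\<And>T. finite T \<Longrightarrow> T \<subseteq> \<Delta> \<times> W \<Longrightarrow> \<exists>h\<in>semidirect \<rho>. \<forall>t\<in>T. h t = g t"
  have near: "\<exists>f u. f \<in> K_of G W \<rho> \<and> u \<in> \<Upsilon> \<and> (\<forall>\<delta>\<in>\<Delta>. \<forall>w\<in>T. g (\<delta>, w) = (act (f w) \<delta>, u w))"
    if T: "finite T" "T \<subseteq> W" for T
  proof -
    have "finite (\<Delta> \<times> T)" "\<Delta> \<times> T \<subseteq> \<Delta> \<times> W"
      using T finite_\<Delta> by auto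
    from approx[OF this] obtain f u where fu: "f \<in> K_of G W \<rho>" "u \<in> \<Upsilon>"
      "\<forall>t\<in>\<Delta> \<times> T. skew f u t = g t"
      by (auto simp: semidirect_def)
    have "g (\<delta>, w) = (act (f w) \<delta>, u w)" if "\<delta> \<in> \<Delta>" "w \<in> T" for \<delta> w
      using fu(3) that T skew_apply[of \<delta> w f u] by force
    then show ?thesis using fu by blast
  qed
  have "\<exists>a v. a \<in> carrier G \<and> (\<forall>\<delta>\<in>\<Delta>. g (\<delta>, w) = (act a \<delta>, v))" if "w \<in> W" for w
    using near[of "{w}"] that K_of_mem[OF _ that] by (metis empty_subsetI finite.emptyI finite_insert insert_subset singletonI)
  then obtain a v where av: "\<And>w. w \<in> W \<Longrightarrow> a w \<in> carrier G"
    "\<And>w \<delta>. w \<in> W \<Longrightarrow> \<delta> \<in> \<Delta> \<Longrightarrow> g (\<delta>, w) = (act (a w) \<delta>, v w)"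
    by metis
  define f where "f = (\<lambda>w\<in>W. a w)"
  define u where "u = (\<lambda>w\<in>W. v w)"
  have fc: "f w \<in> carrier G" if "w \<in> W" for w
    using av(1) that by (simp add: f_def)
  have g_eq: "g (\<delta>, w) = (act (f w) \<delta>, u w)" if "w \<in> W" "\<delta> \<in> \<Delta>" for \<delta> w
    using av(2) that by (simp add: f_def u_def)
  \<comment> \<open>Regularity makes the components unique, so approximating \<open>g\<close> over
    \<open>T\<close> means approximating \<open>f\<close> and \<open>u\<close> on
    \<open>T\<close>.\<close>
  have agree: "\<exists>h t. h \<in> K_of G W \<rho> \<and> t \<in> \<Upsilon> \<and> (\<forall>w\<in>T. h w = f w \<and> t w = u w)"
    if T: "finite T" "T \<subseteq> W" for T
  proof -
    obtain h t where ht: "h \<in> K_of G W \<rho>" "t \<in> \<Upsilon>"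
      "\<forall>\<delta>\<in>\<Delta>. \<forall>w\<in>T. g (\<delta>, w) = (act (h w) \<delta>, t w)"
      using near[OF T] by blast
    have "h w = f w \<and> t w = u w" if w: "w \<in> T" for w
    proof -
      obtain \<delta> where \<delta>: "\<delta> \<in> \<Delta>" by (rule ex_point)
      have wW: "w \<in> W" using w T by blast
      have "(act (h w) \<delta>, t w) = (act (f w) \<delta>, u w)"
        using ht(3) \<delta> w g_eq[OF wW \<delta>] by metis
      then show ?thesis
        using act_eq_iff[OF K_of_mem[OF ht(1) wW] fc[OF wW] \<delta>] by simp
    qed
    then show ?thesis using ht by blast
  qed
  have uB: "u \<in> Bij W"
  proof (rule BijI)
    show "u \<in> extensional W" by (simp add: u_def)
  next
    fix w assume w: "w \<in> W"
    then obtain t where "t \<in> \<Upsilon>" "t w = u w" using agree[of "{w}"] by auto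
    then show "u w \<in> W" using Bij_mem[OF \<Upsilon>_Bij w] by metis
  next
    fix x y assume xy: "x \<in> W" "y \<in> W" "u x = u y"
    then obtain t where t: "t \<in> \<Upsilon>" "t x = u x" "t y = u y" using agree[of "{x, y}"] by auto
    then show "x = y" using Bij_inj[OF \<Upsilon>_Bij[OF t(1)] xy(1,2)] xy(3) by simp
  next
    \<comment> \<open>Injectivity is inherited from the approximations, but surjectivity may be lost
      in a pointwise limit; it is taken from surjectivity of \<open>g\<close>.\<close>
    fix y assume y: "y \<in> W"
    obtain \<delta> where \<delta>: "\<delta> \<in> \<Delta>" by (rule ex_point)
    with y have "(\<delta>, y) \<in> \<Delta> \<times> W" by simp
    then obtain x where x: "x \<in> \<Delta> \<times> W" "(\<delta>, y) = g x" by (rule Bij_surjE[OF g])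
    then have "u (snd x) = y" "snd x \<in> W"
      using g_eq[of "snd x" "fst x"] by auto
    then show "\<exists>x\<in>W. u x = y" by blast
  qed
  have "u \<in> \<Upsilon>"
  proof (rule closedin_Sym_topologyD)
    show "closedin (Sym_topology W) \<Upsilon>" using closed_\<Upsilon> by (simp add: closed_subgroup_Sym_def)
    show "\<exists>h\<in>\<Upsilon>. \<forall>t\<in>T. h t = u t" if "finite T" "T \<subseteq> W" for T
      using agree[OF that] by blast
  qed (rule uB)
  moreover have "f \<in> K_of G W \<rho>"
    unfolding K_of_iff[OF eq]
  proof (intro conjI ballI)
    show "f \<in> carrier (power_group G W)" using av(1) by (simp add: f_def)
    fix z assume "z \<in> \<rho>"
    then obtain x y where z: "z = (x, y)" "(x, y) \<in> \<rho>" by (metis surj_pair)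
    then have "{x, y} \<subseteq> W" using equiv_type[OF eq] by auto
    then obtain h where "h \<in> K_of G W \<rho>" "h x = f x" "h y = f y"
      using agree[of "{x, y}"] by auto
    then show "case z of (x, y) \<Rightarrow> f x = f y"
      using z unfolding K_of_iff[OF eq] by auto
  qed
  moreover have "g = skew f u"
  proof (rule Bij_eqI[OF g])
    show "skew f u \<in> Bij (\<Delta> \<times> W)" by (rule coversD(1)[OF skew_covers[of f, OF fc uB]])
    fix x assume "x \<in> \<Delta> \<times> W"
    then show "g x = skew f u x" using g_eq skew_apply by auto
  qed
  ultimately show "g \<in> semidirect \<rho>" by (auto simp: semidirect_def)
qed

lemma part_skew:
  assumes "f w \<in> carrier G" "w \<in> W"
  shows "part (skew f u) w = act (f w)"
proof (rule extensionalityI[where A = \<Delta>])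
  show "act (f w) \<in> extensional \<Delta>" by (rule Bij_imp_extensional[OF act_Bij[OF assms(1)]])
qed (use assms in \<open>auto simp: part_def skew_apply\<close>)

text \<open>Constant functions belong to \<open>K_of\<close> for every congruence, and with identity
  base component they already induce all of \<open>G\<close> on each fibre. The kernel is
  \<open>K_of\<close> because a \<open>skew\<close> permutation is fibrewise only if its base
  component is the identity.\<close>

lemma semidirect_cover_group:
  assumes \<rho>: "\<rho> \<in> congruences W \<Upsilon>"
  shows "semidirect \<rho> \<in> covering_groups" "cker (semidirect \<rho>) = K_of G W \<rho>"
proof -
  let ?S = "semidirect \<rho>"
  have eq: "equiv W \<rho>" using \<rho> by (auto simp: congruences_def)
  have idU: "(\<lambda>w\<in>W. w) \<in> \<Upsilon>"
    using subgroup.one_closed[OF subgroup_\<Upsilon>] by simp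
  have cov: "covers (skew f u) u" if "f \<in> K_of G W \<rho>" "u \<in> \<Upsilon>" for f u
    using skew_covers K_of_mem \<Upsilon>_Bij that by blast
  have cov_S: "\<exists>u\<in>\<Upsilon>. covers g u" if "g \<in> ?S" for g
    using that cov by (auto simp: semidirect_def)
  have Ker: "Ker_mu \<Delta> W ?S = {g \<in> ?S. fibrewise g}"
    using cov_S by (intro Ker_mu_eq) blast
  have const: "(\<lambda>w\<in>W. a) \<in> K_of G W \<rho>" if "a \<in> carrier G" for a
    using that equiv_type[OF eq] by (auto simp: K_of_iff[OF eq])
  have ind1: "induced_on_fibre \<Delta> W ?S w \<subseteq> act ` carrier G" if w: "w \<in> W" for w
  proof
    fix q assume "q \<in> induced_on_fibre \<Delta> W ?S w"
    then obtain f u where f: "f \<in> K_of G W \<rho>" "q = part (skew f u) w"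
      by (auto simp: induced_on_fibre_part semidirect_def)
    then show "q \<in> act ` carrier G"
      using part_skew[of f, OF K_of_mem[OF f(1) w] w] K_of_mem[OF f(1) w] by simp
  qed
  have ind2: "act ` carrier G \<subseteq> induced_on_fibre \<Delta> W (Ker_mu \<Delta> W ?S) w" if w: "w \<in> W" for w
  proof
    fix q assume "q \<in> act ` carrier G"
    then obtain a where a: "a \<in> carrier G" "q = act a" by blast
    let ?g = "skew (\<lambda>w\<in>W. a) (\<lambda>w\<in>W. w)"
    have fib: "fibrewise ?g" by (rule cov[OF const[OF a(1)] idU])
    then have "?g \<in> Ker_mu \<Delta> W ?S"
      using Ker const[OF a(1)] idU by (auto simp: semidirect_def)
    moreover have "?g ` fibre \<Delta> W w = fibre \<Delta> W w"
      using fib w by (simp add: fibrewise_iff)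
    moreover have "part ?g w = q"
      using part_skew[of "\<lambda>w\<in>W. a" w] a w by simp
    ultimately show "q \<in> induced_on_fibre \<Delta> W (Ker_mu \<Delta> W ?S) w"
      unfolding induced_on_fibre_part by blast
  qed
  have ind3: "induced_on_fibre \<Delta> W (Ker_mu \<Delta> W ?S) w \<subseteq> induced_on_fibre \<Delta> W ?S w" for w
    unfolding induced_on_fibre_part Ker by blast
  show cg: "?S \<in> covering_groups"
  proof (rule cover_groupsI)
    show "closed_subgroup_Sym ?S (\<Delta> \<times> W)"
      using subgroup_semidirect[OF \<rho>] closed_semidirect[OF \<rho>] by (simp add: closed_subgroup_Sym_def)
    show "\<exists>g\<in>?S. covers g u" if "u \<in> \<Upsilon>" for u
      using cov[OF const[OF one_closed] that] const[OF one_closed] that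
      by (auto simp: semidirect_def)
    show "induced_on_fibre \<Delta> W ?S w = act ` carrier G"
      "induced_on_fibre \<Delta> W (Ker_mu \<Delta> W ?S) w = act ` carrier G" if "w \<in> W" for w
      using ind1[OF that] ind2[OF that] ind3[of w] by blast+
  qed (rule cov_S)
  show "cker ?S = K_of G W \<rho>"
  proof (rule cover_kernel_eqI[OF cg])
    show "K_of G W \<rho> \<subseteq> carrier (power_group G W)" by (auto simp: K_of_def)
    show "Ker_mu \<Delta> W ?S = power_act ` K_of G W \<rho>"
    proof
      show "power_act ` K_of G W \<rho> \<subseteq> Ker_mu \<Delta> W ?S"
        unfolding Ker fibrewise_act_eq_skew using cov[OF _ idU] idU by (auto simp: semidirect_def)
      show "Ker_mu \<Delta> W ?S \<subseteq> power_act ` K_of G W \<rho>"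
      proof
        fix g assume "g \<in> Ker_mu \<Delta> W ?S"
        then obtain f u where f: "f \<in> K_of G W \<rho>" "u \<in> \<Upsilon>" "g = skew f u" "fibrewise g"
          unfolding Ker by (auto simp: semidirect_def)
        then have "u = (\<lambda>w\<in>W. w)"
          using covers_mu[OF cov[OF f(1,2)]] covers_mu[OF f(4)] by simp
        then show "g \<in> power_act ` K_of G W \<rho>"
          using f by (simp add: fibrewise_act_eq_skew)
      qed
    qed
  qed
qed

subsection \<open>Every kernel is conjugate to that of its congruence\<close>

text \<open>Identifying \<open>\<Delta>\<close> with \<open>G\<close> through a base point, the automorphisms \<open>\<beta> w\<close> become permutations of
  \<open>\<Delta>\<close> that normalize \<open>G\<close>.\<close>

lemma lift_automorphisms:
  assumes \<beta>: "\<And>w. w \<in> W \<Longrightarrow> \<beta> w \<in> iso G G"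
  obtains p where "fibrewise p" "normalizes p"
    "\<And>f. f \<in> carrier (power_group G W) \<Longrightarrow> conjugate p (power_act f) = power_act (\<lambda>w\<in>W. \<beta> w (f w))"
proof -
  have \<beta>_mult: "\<beta> w (a \<otimes> b) = \<beta> w a \<otimes> \<beta> w b"
    if "w \<in> W" "a \<in> carrier G" "b \<in> carrier G" for w a b
    using \<beta>[OF that(1)] that by (simp add: iso_def hom_mult)
  have \<beta>_bij: "bij_betw (\<beta> w) (carrier G) (carrier G)" if "w \<in> W" for w
    using \<beta>[OF that] by (simp add: iso_def)
  have \<beta>_mem: "\<beta> w a \<in> carrier G" if "w \<in> W" "a \<in> carrier G" for w a
    using \<beta>_bij[OF that(1)] that(2) by (auto simp: bij_betw_def)
  obtain \<delta>\<^sub>0 where \<delta>\<^sub>0: "\<delta>\<^sub>0 \<in> \<Delta>" by (rule ex_point)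
  \<comment> \<open>\<open>c\<close> inverts the orbit map of the base point
    \<open>\<delta>\<^sub>0\<close>, which is a bijection from \<open>G\<close> to
    \<open>\<Delta>\<close> by regularity.\<close>
  define c where "c \<delta> = (SOME a. a \<in> carrier G \<and> act a \<delta>\<^sub>0 = \<delta>)" for \<delta>
  have c: "c \<delta> \<in> carrier G" "act (c \<delta>) \<delta>\<^sub>0 = \<delta>" if "\<delta> \<in> \<Delta>" for \<delta>
  proof -
    have "\<exists>a. a \<in> carrier G \<and> act a \<delta>\<^sub>0 = \<delta>"
      using action.unique_orbit[OF \<delta>\<^sub>0 that] by blast
    from someI_ex[OF this] show "c \<delta> \<in> carrier G" "act (c \<delta>) \<delta>\<^sub>0 = \<delta>"
      by (simp_all add: c_def)
  qed
  have c_act: "c (act a \<delta>) = a \<otimes> c \<delta>" if "a \<in> carrier G" "\<delta> \<in> \<Delta>" for a \<delta>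
  proof -
    have "act (c (act a \<delta>)) \<delta>\<^sub>0 = act (a \<otimes> c \<delta>) \<delta>\<^sub>0"
      using c[OF act_mem[OF that]] c[OF that(2)] that \<delta>\<^sub>0 by (simp add: act_mult)
    then show ?thesis
      using act_eq_iff[OF _ _ \<delta>\<^sub>0] c[OF act_mem[OF that]] c[OF that(2)] that by simp
  qed
  \<comment> \<open>The automorphism transported to \<open>\<Delta>\<close>: it sends
    \<open>act a \<delta>\<^sub>0\<close> to
    \<open>act (\<beta> w a) \<delta>\<^sub>0\<close>.\<close>
  define q where "q w \<delta> = act (\<beta> w (c \<delta>)) \<delta>\<^sub>0" for w \<delta>
  have q_mem: "q w \<delta> \<in> \<Delta>" if "w \<in> W" "\<delta> \<in> \<Delta>" for w \<delta>
    using that c \<beta>_mem \<delta>\<^sub>0 by (simp add: q_def act_mem)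
  \<comment> \<open>Equivariance twisted by \<open>\<beta> w\<close>. This identity yields both the
    normalizing property and the formula for conjugates.\<close>
  have q_act: "q w (act a \<delta>) = act (\<beta> w a) (q w \<delta>)" if "w \<in> W" "a \<in> carrier G" "\<delta> \<in> \<Delta>" for w a \<delta>
    using that c \<beta>_mem \<delta>\<^sub>0 by (simp add: q_def c_act \<beta>_mult act_mult)
  define p where "p = (\<lambda>(\<delta>, w)\<in>\<Delta> \<times> W. (q w \<delta>, w))"
  have p_apply: "p (\<delta>, w) = (q w \<delta>, w)" if "\<delta> \<in> \<Delta>" "w \<in> W" for \<delta> w
    using that by (simp add: p_def)
  have pB: "p \<in> Bij (\<Delta> \<times> W)"
  proof (rule BijI)
    show "p \<in> extensional (\<Delta> \<times> W)" by (simp add: p_def)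
  next
    fix x assume "x \<in> \<Delta> \<times> W"
    then show "p x \<in> \<Delta> \<times> W" using q_mem by (auto simp: p_apply)
  next
    fix x y assume x: "x \<in> \<Delta> \<times> W" and y: "y \<in> \<Delta> \<times> W" and xy: "p x = p y"
    obtain \<delta> w where x: "x = (\<delta>, w)" "\<delta> \<in> \<Delta>" "w \<in> W" using x by blast
    obtain \<epsilon> v where y: "y = (\<epsilon>, v)" "\<epsilon> \<in> \<Delta>" "v \<in> W" using y by blast
    have vw: "v = w" and "act (\<beta> w (c \<delta>)) \<delta>\<^sub>0 = act (\<beta> w (c \<epsilon>)) \<delta>\<^sub>0"
      using xy x y by (auto simp: p_apply q_def)
    then have "\<beta> w (c \<delta>) = \<beta> w (c \<epsilon>)"
      using act_eq_iff[OF \<beta>_mem[OF x(3) c(1)[OF x(2)]] \<beta>_mem[OF x(3) c(1)[OF y(2)]] \<delta>\<^sub>0] by simp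
    then have "c \<delta> = c \<epsilon>"
      using inj_on_eq_iff[OF bij_betw_imp_inj_on[OF \<beta>_bij[OF x(3)]] c(1)[OF x(2)] c(1)[OF y(2)]] by simp
    then have "\<delta> = \<epsilon>"
      using c(2)[OF x(2)] c(2)[OF y(2)] by metis
    then show "x = y"
      using x(1) y(1) vw by simp
  next
    fix y assume "y \<in> \<Delta> \<times> W"
    then obtain \<delta> w where y: "y = (\<delta>, w)" "\<delta> \<in> \<Delta>" "w \<in> W" by blast
    have "c \<delta> \<in> \<beta> w ` carrier G"
      using \<beta>_bij[OF y(3)] c(1)[OF y(2)] by (simp add: bij_betw_def)
    then obtain a where a: "a \<in> carrier G" "\<beta> w a = c \<delta>" by auto
    have "c (act a \<delta>\<^sub>0) = a"
      using act_eq_iff[OF _ a(1) \<delta>\<^sub>0] c[OF act_mem[OF a(1) \<delta>\<^sub>0]] by simp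
    then have "p (act a \<delta>\<^sub>0, w) = y"
      using a y c(2)[OF y(2)] act_mem[OF a(1) \<delta>\<^sub>0] by (simp add: p_apply q_def)
    then show "\<exists>x\<in>\<Delta> \<times> W. p x = y"
      using act_mem[OF a(1) \<delta>\<^sub>0] y(3) by blast
  qed
  have fib: "fibrewise p"
    using pB by (simp add: covers_def id_Bij p_apply)
  have part_p: "part p w \<delta> = q w \<delta>" if "\<delta> \<in> \<Delta>" "w \<in> W" for \<delta> w
    using that by (simp add: part_def p_apply)
  have conj_act: "conj_Bij \<Delta> (part p w) (act a) = act (\<beta> w a)" if "w \<in> W" "a \<in> carrier G" for w a
  proof (rule conj_Bij_eqI)
    show "part p w \<in> Bij \<Delta>"
      using fib that(1) by (intro part_Bij[OF pB]) (auto simp: fibrewise_iff)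
    show "act a \<in> Bij \<Delta>" "act (\<beta> w a) \<in> Bij \<Delta>"
      using that \<beta>_mem act_Bij by auto
    show "act (\<beta> w a) (part p w \<delta>) = part p w (act a \<delta>)" if "\<delta> \<in> \<Delta>" for \<delta>
      using that \<open>w \<in> W\<close> \<open>a \<in> carrier G\<close> by (simp add: part_p act_mem q_act)
  qed
  have "normalizes p"
    unfolding normalizes_def
  proof
    fix w assume w: "w \<in> W"
    have "conj_Bij \<Delta> (part p w) ` act ` carrier G = act ` \<beta> w ` carrier G"
      unfolding image_image using conj_act[OF w] by (intro image_cong) simp_all
    then show "conj_Bij \<Delta> (part p w) ` act ` carrier G = act ` carrier G"
      using \<beta>_bij[OF w] by (simp add: bij_betw_def)
  qed
  moreover have "conjugate p (power_act f) = power_act (\<lambda>w\<in>W. \<beta> w (f w))"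
    if f: "f \<in> carrier (power_group G W)" for f
  proof (rule conj_Bij_eqI[OF pB])
    have fw: "f w \<in> carrier G" if "w \<in> W" for w using f that by auto
    have f': "(\<lambda>w\<in>W. \<beta> w (f w)) \<in> carrier (power_group G W)"
      using fw \<beta>_mem by simp
    show "power_act f \<in> Bij (\<Delta> \<times> W)" "power_act (\<lambda>w\<in>W. \<beta> w (f w)) \<in> Bij (\<Delta> \<times> W)"
      using coversD(1)[OF fibrewise_act_fibrewise[OF f]] coversD(1)[OF fibrewise_act_fibrewise[OF f']]
      by auto
    fix x assume "x \<in> \<Delta> \<times> W"
    then obtain \<delta> w where x: "x = (\<delta>, w)" "\<delta> \<in> \<Delta>" "w \<in> W" by blast
    then show "power_act (\<lambda>w\<in>W. \<beta> w (f w)) (p x) = p (power_act f x)"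
      using fw[OF x(3)] q_mem[OF x(3,2)]
      by (simp add: p_apply fibrewise_act_apply act_mem q_act)
  qed
  ultimately show ?thesis using that fib by blast
qed

text \<open>The automorphism \<open>\<beta> w\<close> sends the value of a kernel element at
  \<open>w\<close> to its value at the representative of the class of \<open>w\<close>. Applied in
  every coordinate, these maps make kernel elements constant on classes; interpolation and
  closedness show that all such functions arise.\<close>

lemma kernel_rel_K_of:
  assumes simple: "simple_group G" and nonab: "\<not> comm_group G" and fin: "finite (carrier G)"
    and F: "F \<in> covering_groups"
  shows "(cker F, K_of G W (rho_of G W (cker F))) \<in> crel"
proof -
  define K where "K = cker F"
  define \<rho> where "\<rho> = rho_of G W K"
  interpret K: simple_subdirect_power G W K
    using subdirect_cover_kernel[OF F] simple nonab
    by (simp add: K_def simple_subdirect_power_def simple_subdirect_power_axioms_def)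
  have eq: "equiv W \<rho>" unfolding \<rho>_def by (rule K.equiv_rho_of[OF fin])
  have \<rho>_iff: "(x, y) \<in> \<rho> \<longleftrightarrow> x \<in> W \<and> y \<in> W \<and> K.determines x y" for x y
    unfolding \<rho>_def by (rule K.rho_of_iff[OF fin])
  \<comment> \<open>The choice depends only on the class as a set, so equivalent points receive the
    same representative.\<close>
  define rep where "rep x = (SOME y. y \<in> \<rho> `` {x})" for x
  have rep: "(x, rep x) \<in> \<rho>" if "x \<in> W" for x
    using someI[of "\<lambda>y. y \<in> \<rho> `` {x}" x] equiv_class_self[OF eq that] by (simp add: rep_def)
  have rep_eq: "rep x = rep y" if "(x, y) \<in> \<rho>" for x y
    using equiv_class_eq[OF eq that] by (simp add: rep_def)
  have repW: "rep x \<in> W" if "x \<in> W" for x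
    using rep[OF that] equiv_type[OF eq] by blast
  \<comment> \<open>Values at \<open>w\<close> and at \<open>rep w\<close> determine each other; one
    direction makes \<open>\<beta> w\<close> well defined, the other makes it injective.\<close>
  have to_rep: "k (rep w) = l (rep w) \<longleftrightarrow> k w = l w" if "w \<in> W" "k \<in> K" "l \<in> K" for k l w
  proof -
    have "(w, rep w) \<in> \<rho>" "(rep w, w) \<in> \<rho>"
      using rep[OF that(1)] eq by (auto simp: equiv_def dest: symD)
    then have "K.determines w (rep w)" "K.determines (rep w) w"
      using \<rho>_iff by auto
    then show ?thesis
      using K.determines_eq that repW[OF that(1)] by metis
  qed
  \<comment> \<open>Any element of \<open>K\<close> with value \<open>a\<close> at \<open>w\<close>
    may be chosen: by \<open>to_rep\<close> its value at \<open>rep w\<close> does not depend on the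
    choice.\<close>
  define \<beta> where "\<beta> w a = (SOME k. k \<in> K \<and> k w = a) (rep w)" for w a
  have \<beta>_K: "\<beta> w (k w) = k (rep w)" if "w \<in> W" "k \<in> K" for w k
  proof -
    have "\<exists>l. l \<in> K \<and> l w = k w" using that by blast
    from someI_ex[OF this] show ?thesis
      unfolding \<beta>_def using to_rep that by blast
  qed
  have \<beta>: "\<beta> w \<in> iso G G" if w: "w \<in> W" for w
  proof (rule isoI)
    have ex: "\<exists>k\<in>K. k w = a" if "a \<in> carrier G" for a
      using K.subdirect[OF w that] .
    show "\<beta> w \<in> hom G G"
    proof (rule homI)
      fix a assume "a \<in> carrier G"
      then obtain k where k: "k \<in> K" "k w = a" using ex by blast
      then show "\<beta> w a \<in> carrier G"
        using \<beta>_K[OF w k(1)] K.K_mem[OF k(1) repW[OF w]] by simp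
      fix b assume "b \<in> carrier G"
      then obtain l where l: "l \<in> K" "l w = b" using ex by blast
      have "\<beta> w ((\<lambda>w\<in>W. k w \<otimes> l w) w) = (\<lambda>w\<in>W. k w \<otimes> l w) (rep w)"
        by (rule \<beta>_K[OF w K.K_mult[OF k(1) l(1)]])
      then show "\<beta> w (a \<otimes> b) = \<beta> w a \<otimes> \<beta> w b"
        using \<beta>_K[OF w k(1)] \<beta>_K[OF w l(1)] k l w repW[OF w] by simp
    qed
    show "bij_betw (\<beta> w) (carrier G) (carrier G)"
    proof (rule bij_betw_imageI)
      show "inj_on (\<beta> w) (carrier G)"
      proof (rule inj_onI)
        fix a b assume "a \<in> carrier G" "b \<in> carrier G" and ab: "\<beta> w a = \<beta> w b"
        then obtain k l where "k \<in> K" "k w = a" "l \<in> K" "l w = b" using ex by metis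
        then show "a = b" using to_rep[OF w] \<beta>_K[OF w] ab by metis
      qed
      show "\<beta> w ` carrier G = carrier G"
      proof
        show "\<beta> w ` carrier G \<subseteq> carrier G"
        proof
          fix b assume "b \<in> \<beta> w ` carrier G"
          then obtain k where k: "k \<in> K" "b = \<beta> w (k w)" using ex by blast
          then show "b \<in> carrier G" using \<beta>_K[OF w k(1)] K.K_mem[OF k(1) repW[OF w]] by simp
        qed
        show "carrier G \<subseteq> \<beta> w ` carrier G"
        proof
          fix b assume "b \<in> carrier G"
          then obtain k where k: "k \<in> K" "k (rep w) = b" using K.subdirect[OF repW[OF w]] by blast
          then show "b \<in> \<beta> w ` carrier G"
            using \<beta>_K[OF w k(1)] K.K_mem[OF k(1) w] by (intro image_eqI[of _ _ "k w"]) simp_all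
        qed
      qed
    qed
  qed
  obtain p where p: "fibrewise p" "normalizes p"
    and conj_p: "\<And>f. f \<in> carrier (power_group G W) \<Longrightarrow>
      conjugate p (power_act f) = power_act (\<lambda>w\<in>W. \<beta> w (f w))"
    using lift_automorphisms[of \<beta>, OF \<beta>] by blast
  have pF: "conjugate p ` F \<in> covering_groups"
    by (rule conj_cover_group[OF F p])
  have image: "(\<lambda>f. \<lambda>w\<in>W. \<beta> w (f w)) ` K = K_of G W \<rho>"
  proof
    show "(\<lambda>f. \<lambda>w\<in>W. \<beta> w (f w)) ` K \<subseteq> K_of G W \<rho>"
    proof
      fix h assume "h \<in> (\<lambda>f. \<lambda>w\<in>W. \<beta> w (f w)) ` K"
      then obtain k where k: "k \<in> K" and h: "h = (\<lambda>w\<in>W. \<beta> w (k w))" by blast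
      have hw: "h w = k (rep w)" if "w \<in> W" for w
        using \<beta>_K[OF that k] that h by simp
      have "h \<in> carrier (power_group G W)"
        using hw K.K_mem[OF k repW] h by (simp add: PiE_iff)
      moreover have "h x = h y" if "(x, y) \<in> \<rho>" for x y
        using hw rep_eq[OF that] that equiv_type[OF eq] by auto
      ultimately show "h \<in> K_of G W \<rho>"
        unfolding K_of_iff[OF eq] by blast
    qed
    show "K_of G W \<rho> \<subseteq> (\<lambda>f. \<lambda>w\<in>W. \<beta> w (f w)) ` K"
    proof
      fix h assume h: "h \<in> K_of G W \<rho>"
      have "\<exists>a. a \<in> carrier G \<and> \<beta> w a = h w" if "w \<in> W" for w
      proof -
        have "h w \<in> \<beta> w ` carrier G"
          using \<beta>[OF that] K_of_mem[OF h that] by (simp add: iso_def bij_betw_def)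
        then show ?thesis by auto
      qed
      then obtain a where a: "\<And>w. w \<in> W \<Longrightarrow> a w \<in> carrier G \<and> \<beta> w (a w) = h w" by metis
      define f where "f = (\<lambda>w\<in>W. a w)"
      \<comment> \<open>\<open>f\<close> is the coordinatewise preimage of \<open>h\<close>; as
        kernels are closed, it suffices to match it on finite sets.\<close>
      have "f \<in> K"
        unfolding K_def
      proof (rule cover_kernel_closed[OF F])
        show "f \<in> carrier (power_group G W)" using a by (simp add: f_def)
        fix T assume T: "finite T" "T \<subseteq> W"
        \<comment> \<open>Distinct representatives are inequivalent, so \<open>h\<close> can be
          interpolated on them. Injectivity of \<open>\<beta> t\<close> then forces the
          interpolating element to agree with \<open>f\<close> at every \<open>t\<close> in
          \<open>T\<close>.\<close>
        have "\<exists>k\<in>K. \<forall>t\<in>rep ` T. k t = h t"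
        proof (rule K.interpolating_element)
          show "finite (rep ` T)" "rep ` T \<subseteq> W" using T repW by auto
          show "h t \<in> carrier G" if "t \<in> rep ` T" for t
            using that T repW K_of_mem[OF h] by auto
          show "\<not> K.determines s t" if st: "s \<in> rep ` T" "t \<in> rep ` T" "s \<noteq> t" for s t
          proof
            assume "K.determines s t"
            moreover obtain x y where xy: "x \<in> W" "y \<in> W" "s = rep x" "t = rep y"
              using st T by auto
            ultimately have "(rep x, rep y) \<in> \<rho>"
              using \<rho>_iff repW by simp
            then have "rep (rep x) = rep (rep y)" by (rule rep_eq)
            then have "rep x = rep y"
              using rep_eq[OF rep[OF xy(1)]] rep_eq[OF rep[OF xy(2)]] by simp
            then show False using st(3) xy by simp
          qed
        qed
        then obtain k where k: "k \<in> K" "\<forall>t\<in>rep ` T. k t = h t" by blast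
        have "k t = f t" if t: "t \<in> T" for t
        proof -
          have tW: "t \<in> W" using t T by blast
          have "h (rep t) = h t"
            using h rep[OF tW] unfolding K_of_iff[OF eq] by auto
          then have "\<beta> t (k t) = \<beta> t (a t)"
            using \<beta>_K[OF tW k(1)] k(2) t a[OF tW] by simp
          then have "k t = a t"
            using \<beta>[OF tW] K.K_mem[OF k(1) tW] a[OF tW]
            unfolding iso_def bij_betw_def by (blast dest: inj_onD)
          then show ?thesis using tW by (simp add: f_def)
        qed
        then show "\<exists>k\<in>cker F. \<forall>t\<in>T. k t = f t"
          using k(1) unfolding K_def by blast
      qed
      moreover have "h = (\<lambda>w\<in>W. \<beta> w (f w))"
      proof (rule extensionalityI[where A = W])
        show "h \<in> extensional W" using h by (auto simp: K_of_def PiE_def)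
      qed (use a in \<open>auto simp: f_def\<close>)
      ultimately show "h \<in> (\<lambda>f. \<lambda>w\<in>W. \<beta> w (f w)) ` K" by blast
    qed
  qed
  have "cker (conjugate p ` F) = K_of G W \<rho>"
  proof (rule cover_kernel_eqI[OF pF])
    show "K_of G W \<rho> \<subseteq> carrier (power_group G W)" by (auto simp: K_of_def)
    have "Ker_mu \<Delta> W (conjugate p ` F) = (\<lambda>k. conjugate p (power_act k)) ` K"
      unfolding Ker_mu_conj[OF F p(1)] Ker_mu_eq_fibrewise_act[OF F] K_def image_image ..
    also have "\<dots> = (\<lambda>k. power_act (\<lambda>w\<in>W. \<beta> w (k w))) ` K"
      using conj_p K.K_PiE by (intro image_cong) simp_all
    also have "\<dots> = power_act ` K_of G W \<rho>"
      unfolding image[symmetric] image_image ..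
    finally show "Ker_mu \<Delta> W (conjugate p ` F) = power_act ` K_of G W \<rho>" .
  qed
  then show ?thesis
    using kernel_relI[OF F p(1) pF] by (simp add: K_def \<rho>_def)
qed

text \<open>By \<open>semidirect_cover_group\<close> the criterion for kernels applies to
  \<open>K_of\<close>. Values on different classes are independent, so a nontrivial element of
  \<open>G\<close> suffices to tell the classes apart.\<close>

lemma rho_of_K_of:
  assumes fin: "finite (carrier G)" and nontriv: "carrier G \<noteq> {\<one>}" and \<rho>: "\<rho> \<in> congruences W \<Upsilon>"
  shows "rho_of G W (K_of G W \<rho>) = \<rho>"
proof -
  have eq: "equiv W \<rho>" using \<rho> by (auto simp: congruences_def)
  have iff: "(x, y) \<in> rho_of G W (K_of G W \<rho>) \<longleftrightarrow>
    x \<in> W \<and> y \<in> W \<and> (\<forall>k\<in>K_of G W \<rho>. k x = \<one> \<longrightarrow> k y = \<one>)" for x y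
    using rho_of_cover_kernel[OF fin semidirect_cover_group(1)[OF \<rho>]]
    unfolding semidirect_cover_group(2)[OF \<rho>] .
  have "(x, y) \<in> rho_of G W (K_of G W \<rho>) \<longleftrightarrow> (x, y) \<in> \<rho>" for x y
  proof
    assume L: "(x, y) \<in> rho_of G W (K_of G W \<rho>)"
    show "(x, y) \<in> \<rho>"
    proof (rule ccontr)
      assume neg: "(x, y) \<notin> \<rho>"
      obtain a where a: "a \<in> carrier G" "a \<noteq> \<one>" using nontriv one_closed by blast
      \<comment> \<open>Trivial on the class of \<open>x\<close> and equal to \<open>a\<close> on
        all other classes, in particular at \<open>y\<close>.\<close>
      let ?k = "\<lambda>w\<in>W. if (x, w) \<in> \<rho> then \<one> else a"
      have "?k v = ?k w" if "(v, w) \<in> \<rho>" for v w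
      proof -
        have "(x, v) \<in> \<rho> \<longleftrightarrow> (x, w) \<in> \<rho>"
          using that eq unfolding equiv_def by (meson symD transD)
        then show ?thesis using that equiv_type[OF eq] by auto
      qed
      then have "\<forall>(v, w)\<in>\<rho>. ?k v = ?k w" by blast
      moreover have "?k \<in> carrier (power_group G W)" using a by simp
      ultimately have "?k \<in> K_of G W \<rho>"
        unfolding K_of_iff[OF eq] by blast
      moreover have "?k x = \<one>" "?k y \<noteq> \<one>"
        using L iff neg a equiv_class_self[OF eq, of x] by auto
      ultimately show False using L iff by blast
    qed
  next
    assume xy: "(x, y) \<in> \<rho>"
    have "k y = \<one>" if "k \<in> K_of G W \<rho>" "k x = \<one>" for k
    proof -
      have "k x = k y" using that(1) xy unfolding K_of_iff[OF eq] by blast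
      then show ?thesis using that(2) by simp
    qed
    then show "(x, y) \<in> rho_of G W (K_of G W \<rho>)"
      unfolding iff using equiv_type[OF eq] xy by blast
  qed
  then show ?thesis by (auto simp: set_eq_iff)
qed

end

section \<open>Assembly of the bijection and its inverse\<close>

theorem theorem11:
  fixes G :: "('g, 'b) monoid_scheme"
    and act :: "'g \<Rightarrow> 'd \<Rightarrow> 'd"
    and \<Delta> :: "'d set"
    and W :: "'w set"
    and \<Upsilon> :: "('w \<Rightarrow> 'w) set"
  assumes "countable W"
    and "closed_subgroup_Sym \<Upsilon> W"
    and "transitive_action (BijGroup W\<lparr>carrier := \<Upsilon>\<rparr>) W (\<lambda>g. g)"
    and "simple_group G" and "\<not> comm_group G" and "finite (carrier G)"
    and "finite \<Delta>" and "regular_action G \<Delta> act"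
  shows "(\<forall>F\<in>cover_groups G act \<Delta> W \<Upsilon>.
            Ker_mu \<Delta> W F = fibrewise_act act \<Delta> W ` cover_kernel G act \<Delta> W F)
    \<and> (\<forall>K\<in>cover_kernels G act \<Delta> W \<Upsilon>. subgroup K (power_group G W))
    \<and> equiv (cover_kernels G act \<Delta> W \<Upsilon>) (kernel_rel G act \<Delta> W \<Upsilon>)
    \<and> (\<forall>\<rho>\<in>congruences W \<Upsilon>. K_of G W \<rho> \<in> cover_kernels G act \<Delta> W \<Upsilon>)
    \<and> bij_betw (\<lambda>\<rho>. kernel_rel G act \<Delta> W \<Upsilon> `` {K_of G W \<rho>})
        (congruences W \<Upsilon>) (cover_kernels G act \<Delta> W \<Upsilon> // kernel_rel G act \<Delta> W \<Upsilon>)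
    \<and> (\<forall>K\<in>cover_kernels G act \<Delta> W \<Upsilon>. rho_of G W K \<in> congruences W \<Upsilon>)
    \<and> rho_of G W respects kernel_rel G act \<Delta> W \<Upsilon>
    \<and> (\<forall>K\<in>cover_kernels G act \<Delta> W \<Upsilon>.
         inv_into (congruences W \<Upsilon>) (\<lambda>\<rho>. kernel_rel G act \<Delta> W \<Upsilon> `` {K_of G W \<rho>})
           (kernel_rel G act \<Delta> W \<Upsilon> `` {K}) = rho_of G W K)"
proof -
  interpret cover_theory G act \<Delta> W \<Upsilon>
    using assms by (simp add: cover_theory_def cover_theory_axioms_def regular_cover_def)
  note fin = \<open>finite (carrier G)\<close>
  let ?\<C> = "congruences W \<Upsilon>" and ?\<Psi> = "\<lambda>\<rho>. crel `` {K_of G W \<rho>}"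
  note equiv = equiv_kernel_rel
  have K_of: "K_of G W \<rho> \<in> ckers" if "\<rho> \<in> ?\<C>" for \<rho>
    using semidirect_cover_group[OF that] unfolding cover_kernels_def by (metis image_eqI)
  have rho_cong: "rho_of G W K \<in> ?\<C>" if "K \<in> ckers" for K
    using that rho_of_congruence[OF fin] by (auto simp: cover_kernels_def)
  have rho_K: "rho_of G W (K_of G W \<rho>) = \<rho>" if "\<rho> \<in> ?\<C>" for \<rho>
    using rho_of_K_of[OF fin simple_group.simple_not_triv[OF \<open>simple_group G\<close>] that] .
  \<comment> \<open>Each kernel is related to \<open>K_of\<close> of its own congruence, which gives
    both surjectivity and the formula for the inverse.\<close>
  have cls: "crel `` {K} = ?\<Psi> (rho_of G W K)" if K: "K \<in> ckers" for K
  proof -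
    have "(K, K_of G W (rho_of G W K)) \<in> crel"
      using K kernel_rel_K_of[OF assms(4-6)] by (auto simp: cover_kernels_def)
    then show ?thesis by (rule equiv_class_eq[OF equiv])
  qed
  \<comment> \<open>\<open>rho_of\<close> is constant on classes and recovers \<open>\<rho>\<close>
    from \<open>K_of G W \<rho>\<close>, so it is a left inverse of the map on classes.\<close>
  have inj: "inj_on ?\<Psi> ?\<C>"
  proof (rule inj_onI)
    fix \<rho> \<sigma> assume \<rho>: "\<rho> \<in> ?\<C>" and \<sigma>: "\<sigma> \<in> ?\<C>" and "?\<Psi> \<rho> = ?\<Psi> \<sigma>"
    then have "(K_of G W \<rho>, K_of G W \<sigma>) \<in> crel"
      using eq_equiv_class[OF _ equiv K_of] by blast
    then show "\<rho> = \<sigma>"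
      using rho_of_kernel_rel[OF fin] rho_K \<rho> \<sigma> by metis
  qed
  have "bij_betw ?\<Psi> ?\<C> (ckers // crel)"
  proof (rule bij_betw_imageI[OF inj])
    show "?\<Psi> ` ?\<C> = ckers // crel"
    proof
      show "?\<Psi> ` ?\<C> \<subseteq> ckers // crel" using K_of by (auto intro: quotientI)
      show "ckers // crel \<subseteq> ?\<Psi> ` ?\<C>"
      proof
        fix X assume "X \<in> ckers // crel"
        then obtain K where "K \<in> ckers" "X = crel `` {K}" by (rule quotientE)
        then show "X \<in> ?\<Psi> ` ?\<C>" using cls rho_cong by blast
      qed
    qed
  qed
  moreover have "inv_into ?\<C> ?\<Psi> (crel `` {K}) = rho_of G W K" if "K \<in> ckers" for K
    using inv_into_f_f[OF inj rho_cong[OF that]] cls[OF that] by simp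
  moreover have "rho_of G W respects crel"
    using rho_of_kernel_rel[OF fin] by (auto intro: congruentI)
  moreover have "\<forall>K\<in>ckers. subgroup K (power_group G W)"
    using subgroup_cover_kernel by (auto simp: cover_kernels_def)
  ultimately show ?thesis
    using Ker_mu_eq_fibrewise_act equiv K_of rho_cong by blast
qed

end
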